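(* Let $n$ and $d\ge 1$ be integers with $2d\mid n$, and let $G$ be a simple, finite, loopless, $n$-vertex, $d$-regular graph. Let $q\ge \ell\ge 1$ be integers and let $H_q^\ell$ be the complete looped graph on $q$ vertices with $\ell$ loops deleted. Then for $q > 2^{nd/2}$ we have $$ \mathrm{hom}(G,H_q^\ell) \leq \mathrm{hom}(K_{d,d},H_q^\ell)^{\frac{n}{2d}}, $$ with equality if and only if $G$ is (isomorphic to) the disjoint union of $n/2d$ copies of $K_{d,d}$.
   Context: For graphs $G$ and $H$ (with $H$ possibly having loops), $\mathrm{hom}(G,H)$ is the number of maps $f:V(G)\to V(H)$ such that $uv\in E(G)$ implies $f(u)f(v)\in E(H)$. The complete looped graph on $q$ vertices has every pair of distinct vertices adjacent and a loop at every vertex. $K_{d,d}$ is the complete bipartite graph with $d$ vertices in each class. *)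

theory Defs
  imports "Graph_Theory.Graph_Theory" "HOL-Library.FuncSet"
begin

text \<open>
  Following the AFP entry on graph theory, an undirected graph is a symmetric set of vertex pairs: an edge
  \<open>uv\<close> is the two pairs \<open>(u,v)\<close> and \<open>(v,u)\<close>, a loop is the single pair \<open>(v,v)\<close>. A finite simple
  loopless graph is a \<^locale>\<open>pair_graph\<close>; a finite graph possibly with loops is a
  \<^locale>\<open>pair_pseudo_graph\<close>. In a \<^locale>\<open>pair_graph\<close> the out-degree is the usual degree.
\<close>

definition regular :: "'a pair_pre_digraph \<Rightarrow> nat \<Rightarrow> bool" where
  "regular G d \<longleftrightarrow> (\<forall>v \<in> pverts G. out_degree (with_proj G) v = d)"

text \<open>
  Maps on the vertex set are represented by extensional functions, so that two maps agreeing
  on the vertices of \<open>G\<close> are counted once.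
\<close>

definition graph_homs :: "'a pair_pre_digraph \<Rightarrow> 'b pair_pre_digraph \<Rightarrow> ('a \<Rightarrow> 'b) set" where
  "graph_homs G H =
     {f \<in> pverts G \<rightarrow>\<^sub>E pverts H. \<forall>u v. (u, v) \<in> parcs G \<longrightarrow> (f u, f v) \<in> parcs H}"

definition hom_count :: "'a pair_pre_digraph \<Rightarrow> 'b pair_pre_digraph \<Rightarrow> nat" where
  "hom_count G H = card (graph_homs G H)"

definition complete_looped :: "nat \<Rightarrow> nat pair_pre_digraph" where
  "complete_looped q = \<lparr> pverts = {..<q}, parcs = {..<q} \<times> {..<q} \<rparr>"

text \<open>
  All choices of \<open>l\<close> loops give isomorphic graphs; the loops deleted here are those at
  \<open>0, \<dots>, l - 1\<close>.
\<close>

definition complete_looped_del :: "nat \<Rightarrow> nat \<Rightarrow> nat pair_pre_digraph" where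
  "complete_looped_del q l =
     \<lparr> pverts = pverts (complete_looped q),
       parcs = parcs (complete_looped q) - {(i, i) | i. i < l} \<rparr>"

definition complete_bipartite :: "nat \<Rightarrow> nat \<Rightarrow> (nat + nat) pair_pre_digraph" where
  "complete_bipartite a b =
     \<lparr> pverts = {..<a} <+> {..<b},
       parcs = (Inl ` {..<a}) \<times> (Inr ` {..<b}) \<union> (Inr ` {..<b}) \<times> (Inl ` {..<a}) \<rparr>"

definition disjoint_copies :: "nat \<Rightarrow> 'a pair_pre_digraph \<Rightarrow> (nat \<times> 'a) pair_pre_digraph" where
  "disjoint_copies k G =
     \<lparr> pverts = {..<k} \<times> pverts G,
       parcs = {((i, u), (i, v)) | i u v. i < k \<and> (u, v) \<in> parcs G} \<rparr>"

lemma complete_bipartite_digraph_complete_bipartite: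
  "complete_bipartite_digraph a b (with_proj (complete_bipartite a b))"
  unfolding complete_bipartite_digraph_pair_def
proof (intro conjI exI)
  show "pverts (complete_bipartite a b) = Inl ` {..<a} \<union> Inr ` {..<b}"
    by (simp add: complete_bipartite_def Plus_def)
  show "Inl ` {..<a} \<inter> Inr ` {..<b} = {}"
    by auto
qed (simp_all add: complete_bipartite_def card_image)

lemma pair_pseudo_graph_complete_looped_del:
  "pair_pseudo_graph (complete_looped_del q l)"
proof -
  have "finite (parcs (complete_looped_del q l))"
    by (simp add: complete_looped_del_def complete_looped_def)
  then show ?thesis
    by unfold_locales
      (auto simp: complete_looped_del_def complete_looped_def symmetric_def sym_def)
qed

end

theory Submission
  imports Defs
begin

text \<open>
  Inclusion-exclusion over the edges that are coloured constantly by a colour below \<open>l\<close> writes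
  \<open>hom(G, H) / q ^ n\<close> as the alternating sum, over edge sets \<open>S\<close>, of the probability \<open>p(S)\<close> that a random
  map makes all edges of \<open>S\<close> constant below \<open>l\<close>. If \<open>S\<close> contains a forest with \<open>r\<close> edges, then
  \<open>p(S) \<le> l / q ^ (r + 1)\<close>. The contributions of the sets with at most two edges
  depend only on \<open>n\<close> and \<open>d\<close>, and so do those of the triples in a triangle-free graph. Since there are at most \<open>2 ^ (nd/2) < q\<close> terms,
  the comparison is decided by the first term that differs: a triangle costs \<open>l / q ^ 3\<close>,
  and among triangle-free graphs a 4-cycle gains \<open>l / q ^ 4\<close>. An edge of a triangle-free graph lies
  in at most \<open>(d - 1) ^ 2\<close> 4-cycles, and all edges attain this exactly when every component is \<open>K_{d,d}\<close>.
\<close>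

section \<open>Probabilities of constant edge sets\<close>

text \<open>The right-hand side of the theorem is the homomorphism count of the disjoint union of
  n/2d copies of K_{d,d}, which is again d-regular on n vertices. So the task is to compare two
  graphs with equally many vertices and edges, and no entropy argument is needed. A forest S with j
  edges covering m vertices has m - j components, whence p(S) = l^(m-j) / q^m. For few edges only
  the distribution of the cover size m matters, and three edges are the first place where a
  non-forest, the triangle, can occur. Its odd size gives it a negative sign; the even size of a
  4-cycle gives it a positive one. The threshold 2^(nd/2) arises exactly: after the leading terms
  are separated, the error of each graph is an alternating sum, bounded by the terms of one sign
  only, that is by half of the 2^(nd/2) subsets. The two errors together therefore stay below q
  times the common bound on a single term, which is the size of one leading term.\<close>

definition constant_below :: "nat \<Rightarrow> ('a \<Rightarrow> nat) \<Rightarrow> 'a set \<Rightarrow> bool" where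
  "constant_below l f e \<longleftrightarrow> (\<exists>c<l. \<forall>x\<in>e. f x = c)"

text \<open>
  The members of \<open>S\<close> may be vertex sets of any size, so that a connected set of edges can be replaced by
  the single set of vertices it covers.
\<close>

definition mono_maps :: "'a set \<Rightarrow> nat \<Rightarrow> nat \<Rightarrow> 'a set set \<Rightarrow> ('a \<Rightarrow> nat) set" where
  "mono_maps V q l S = {f \<in> V \<rightarrow>\<^sub>E {..<q}. \<forall>e\<in>S. constant_below l f e}"

definition mono_prob :: "'a set \<Rightarrow> nat \<Rightarrow> nat \<Rightarrow> 'a set set \<Rightarrow> real" where
  "mono_prob V q l S = real (card (mono_maps V q l S)) / real q ^ card V"

lemma constant_below_mono: "constant_below l f B \<Longrightarrow> A \<subseteq> B \<Longrightarrow> constant_below l f A"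
  by (auto simp: constant_below_def)

lemma constant_below_cong: "(\<And>x. x \<in> e \<Longrightarrow> f x = g x) \<Longrightarrow> constant_below l f e = constant_below l g e"
  by (simp add: constant_below_def)

lemma constant_below_merge:
  "A \<inter> B \<noteq> {} \<Longrightarrow> constant_below l f A \<and> constant_below l f B \<longleftrightarrow> constant_below l f (A \<union> B)"
  unfolding constant_below_def by fastforce

lemma constant_below_pair: "constant_below l f {u, v} \<longleftrightarrow> f u = f v \<and> f u < l"
  by (auto simp: constant_below_def)

lemma finite_mono_maps: "finite V \<Longrightarrow> finite (mono_maps V q l S)"
  unfolding mono_maps_def by (rule finite_subset[of _ "V \<rightarrow>\<^sub>E {..<q}"]) (auto intro: finite_PiE)

lemma mono_prob_nonneg: "mono_prob V q l S \<ge> 0"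
  by (simp add: mono_prob_def)

lemma mono_prob_antimono:
  assumes "finite V" "S \<subseteq> T"
  shows "mono_prob V q l T \<le> mono_prob V q l S"
proof -
  have "mono_maps V q l T \<subseteq> mono_maps V q l S"
    using assms(2) by (auto simp: mono_maps_def)
  then have "card (mono_maps V q l T) \<le> card (mono_maps V q l S)"
    by (intro card_mono finite_mono_maps assms)
  then show ?thesis
    by (simp add: mono_prob_def divide_right_mono)
qed

lemma mono_prob_empty:
  assumes "finite V" "q > 0"
  shows "mono_prob V q l {} = 1"
  using assms by (simp add: mono_prob_def mono_maps_def card_PiE)

lemma mono_prob_cong:
  assumes "\<And>f. (\<forall>e\<in>S. constant_below l f e) \<longleftrightarrow> (\<forall>e\<in>T. constant_below l f e)"
  shows "mono_prob V q l S = mono_prob V q l T"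
  using assms by (simp add: mono_prob_def mono_maps_def)

lemma mono_prob_merge:
  assumes "A \<inter> B \<noteq> {}"
  shows "mono_prob V q l (insert A (insert B S)) = mono_prob V q l (insert (A \<union> B) S)"
  by (rule mono_prob_cong) (use constant_below_merge[OF assms] in auto)

text \<open>Restriction to the two parts is inverse to gluing, so conditions that look at disjoint
  parts of \<open>V\<close> are independent.\<close>

lemma card_split_maps:
  assumes AV: "A \<subseteq> V" and X: "X \<subseteq> A \<rightarrow>\<^sub>E Q" and Y: "Y \<subseteq> (V - A) \<rightarrow>\<^sub>E Q"
  shows "card {f \<in> V \<rightarrow>\<^sub>E Q. restrict f A \<in> X \<and> restrict f (V - A) \<in> Y} = card X * card Y"
proof -
  let ?F = "{f \<in> V \<rightarrow>\<^sub>E Q. restrict f A \<in> X \<and> restrict f (V - A) \<in> Y}"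
  let ?h = "\<lambda>f. (restrict f A, restrict f (V - A))"
  let ?g = "\<lambda>(a, b) x. if x \<in> A then a x else b x"
  have g: "restrict (?g p) A = fst p" "restrict (?g p) (V - A) = snd p" "?g p \<in> V \<rightarrow>\<^sub>E Q"
    if p: "p \<in> X \<times> Y" for p
  proof -
    obtain a b where ab: "p = (a, b)" "a \<in> A \<rightarrow>\<^sub>E Q" "b \<in> (V - A) \<rightarrow>\<^sub>E Q"
      using p X Y by blast
    then show "restrict (?g p) A = fst p" "restrict (?g p) (V - A) = snd p"
      by (auto simp: fun_eq_iff restrict_def PiE_def extensional_def)
    show "?g p \<in> V \<rightarrow>\<^sub>E Q"
      unfolding PiE_def extensional_def using ab AV
      by (auto simp: PiE_def extensional_def Pi_def)
  qed
  have "bij_betw ?h ?F (X \<times> Y)"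
    unfolding bij_betw_def
  proof
    show "inj_on ?h ?F"
    proof (rule inj_onI)
      fix f g assume fg: "f \<in> ?F" "g \<in> ?F" and eq: "?h f = ?h g"
      show "f = g"
      proof
        fix x
        have "restrict f A x = restrict g A x" "restrict f (V - A) x = restrict g (V - A) x"
          using eq by auto
        moreover have "x \<notin> V \<Longrightarrow> f x = g x"
          using fg by (auto simp: PiE_def extensional_def)
        ultimately show "f x = g x"
          by (auto simp: restrict_def split: if_splits)
      qed
    qed
    show "?h ` ?F = X \<times> Y"
    proof
      show "X \<times> Y \<subseteq> ?h ` ?F"
      proof
        fix p assume p: "p \<in> X \<times> Y"
        have "?g p \<in> ?F" "p = ?h (?g p)"
          using p g[OF p] by auto
        then show "p \<in> ?h ` ?F" by blast
      qed
    qed auto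
  qed
  then have "card ?F = card (X \<times> Y)"
    by (rule bij_betw_same_card)
  then show ?thesis
    by (simp add: card_cartesian_product)
qed

lemma constant_below_restrict:
  assumes "\<Union>S \<subseteq> B"
  shows "(\<forall>e\<in>S. constant_below l (restrict f B) e) \<longleftrightarrow> (\<forall>e\<in>S. constant_below l f e)"
proof (rule ball_cong[OF refl])
  fix e assume "e \<in> S"
  then have "x \<in> B" if "x \<in> e" for x
    using assms that by blast
  then show "constant_below l (restrict f B) e = constant_below l f e"
    by (intro constant_below_cong) simp
qed

lemma mono_maps_restrict:
  assumes "\<Union>S \<subseteq> B" "B \<subseteq> V" "f \<in> V \<rightarrow>\<^sub>E {..<q}"
  shows "restrict f B \<in> mono_maps B q l S \<longleftrightarrow> (\<forall>e\<in>S. constant_below l f e)"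
proof -
  have "restrict f B \<in> B \<rightarrow>\<^sub>E {..<q}"
    using assms(2,3) by (auto simp: PiE_def Pi_def)
  then show ?thesis
    by (simp add: mono_maps_def constant_below_restrict[OF assms(1)])
qed

lemma card_mono_maps_split:
  assumes "A \<subseteq> V" "\<Union>R \<subseteq> A" "\<Union>S \<subseteq> V - A"
  shows "card (mono_maps V q l (R \<union> S)) = card (mono_maps A q l R) * card (mono_maps (V - A) q l S)"
proof -
  have "card (mono_maps A q l R) * card (mono_maps (V - A) q l S)
      = card {f \<in> V \<rightarrow>\<^sub>E {..<q}. restrict f A \<in> mono_maps A q l R \<and> restrict f (V - A) \<in> mono_maps (V - A) q l S}"
    by (rule card_split_maps[symmetric]) (use assms in \<open>auto simp: mono_maps_def\<close>)
  also have "{f \<in> V \<rightarrow>\<^sub>E {..<q}. restrict f A \<in> mono_maps A q l R \<and> restrict f (V - A) \<in> mono_maps (V - A) q l S}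
     = mono_maps V q l (R \<union> S)"
    unfolding mono_maps_def[of V]
    by (intro Collect_cong conj_cong refl)
      (simp only: mono_maps_restrict[OF assms(2,1)] mono_maps_restrict[OF assms(3) Diff_subset] ball_Un)
  finally show ?thesis ..
qed

lemma mono_prob_split:
  assumes "finite V" "A \<subseteq> V" "\<Union>R \<subseteq> A" "\<Union>S \<subseteq> V - A"
  shows "mono_prob V q l (R \<union> S) = mono_prob A q l R * mono_prob (V - A) q l S"
proof -
  have "card V = card A + card (V - A)"
    using assms by (metis card_Diff_subset card_mono finite_subset le_add_diff_inverse)
  then show ?thesis
    using card_mono_maps_split[OF assms(2-4)] by (simp add: mono_prob_def power_add)
qed

text \<open>Vertices outside \<open>B\<close> are unconstrained and contribute the factor 1. The
  normalised count thus does not depend on the ambient vertex set, which permits passing to smaller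
  vertex sets at will.\<close>

lemma mono_prob_subset:
  assumes "finite V" "q > 0" "B \<subseteq> V" "\<Union>S \<subseteq> B"
  shows "mono_prob V q l S = mono_prob B q l S"
proof -
  have "mono_prob V q l (S \<union> {}) = mono_prob B q l S * mono_prob (V - B) q l {}"
    by (rule mono_prob_split) (use assms in auto)
  then show ?thesis
    using assms by (simp add: mono_prob_empty)
qed

text \<open>Exactly the \<open>l\<close> constant maps with value below \<open>l\<close> qualify;
  nonemptiness of \<open>A\<close> keeps them distinct.\<close>

lemma mono_prob_whole:
  assumes "finite A" "A \<noteq> {}" "l \<le> q"
  shows "mono_prob A q l {A} = real l / real q ^ card A"
proof -
  have "mono_maps A q l {A} = (\<lambda>c. \<lambda>x\<in>A. c) ` {..<l}"
  proof
    show "mono_maps A q l {A} \<subseteq> (\<lambda>c. \<lambda>x\<in>A. c) ` {..<l}"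
      by (auto simp: mono_maps_def constant_below_def PiE_def extensional_def restrict_def fun_eq_iff
          intro!: image_eqI)
    show "(\<lambda>c. \<lambda>x\<in>A. c) ` {..<l} \<subseteq> mono_maps A q l {A}"
      using assms(3) by (auto simp: mono_maps_def constant_below_def)
  qed
  moreover have "inj_on (\<lambda>c. \<lambda>x\<in>A. c) {..<l}"
    using assms(2) by (auto simp: inj_on_def fun_eq_iff restrict_def)
  ultimately show ?thesis
    by (simp add: mono_prob_def card_image)
qed

lemma mono_prob_disjoint:
  assumes "finite V" "A \<subseteq> V" "A \<noteq> {}" "l \<le> q" "q > 0" "\<Union>S \<subseteq> V - A"
  shows "mono_prob V q l (insert A S) = real l / real q ^ card A * mono_prob V q l S"
proof -
  have "mono_prob V q l (insert A S) = mono_prob A q l {A} * mono_prob (V - A) q l S"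
    using mono_prob_split[of V A "{A}" S q l] assms by simp
  also have "mono_prob (V - A) q l S = mono_prob V q l S"
    by (rule mono_prob_subset[symmetric]) (use assms in auto)
  finally show ?thesis
    using assms by (simp add: mono_prob_whole finite_subset)
qed

lemma mono_prob_single:
  assumes "finite V" "A \<subseteq> V" "A \<noteq> {}" "l \<le> q" "q > 0"
  shows "mono_prob V q l {A} = real l / real q ^ card A"
  using mono_prob_disjoint[of V A l q "{}"] assms by (simp add: mono_prob_empty)

text \<open>An endpoint \<open>v\<close> of \<open>e\<close> that \<open>S\<close> leaves uncovered
  must copy the value of the other endpoint, so forgetting \<open>v\<close> is injective on the
  qualifying maps and the probability drops by a factor of at least \<open>q\<close>. Iterating this
  along a forest gives the upper bounds for large edge sets.\<close>

lemma mono_prob_extend: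
  assumes "finite V" "q > 0" "card e = 2" "e \<subseteq> V" "\<not> e \<subseteq> \<Union>S" "\<Union>S \<subseteq> V"
  shows "mono_prob V q l (insert e S) \<le> mono_prob V q l S / real q"
proof -
  obtain v where v: "v \<in> e" "v \<notin> \<Union>S"
    using assms by blast
  obtain u where u: "e = {u, v}" "u \<noteq> v"
    using assms(3) v by (auto simp: card_2_iff)
  let ?W = "V - {v}"
  have S: "\<Union>S \<subseteq> ?W" using v assms by blast
  have "card (mono_maps V q l (insert e S)) \<le> card (mono_maps ?W q l S)"
  proof (rule card_inj_on_le[of "\<lambda>f. restrict f ?W"])
    show "inj_on (\<lambda>f. restrict f ?W) (mono_maps V q l (insert e S))"
    proof (rule inj_onI)
      fix f g assume f: "f \<in> mono_maps V q l (insert e S)" and g: "g \<in> mono_maps V q l (insert e S)"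
        and eq: "restrict f ?W = restrict g ?W"
      have fg: "f x = g x" if "x \<in> ?W" for x
        using eq that by (metis restrict_apply')
      have "f v = f u" "g v = g u"
        using f g u by (auto simp: mono_maps_def constant_below_pair)
      then have "f v = g v"
        using fg[of u] u assms(4) by auto
      then show "f = g"
        using fg f g by (intro PiE_ext[of f V "\<lambda>_. {..<q}" g]) (auto simp: mono_maps_def)
    qed
    show "(\<lambda>f. restrict f ?W) ` mono_maps V q l (insert e S) \<subseteq> mono_maps ?W q l S"
    proof
      fix g assume "g \<in> (\<lambda>f. restrict f ?W) ` mono_maps V q l (insert e S)"
      then obtain f where f: "f \<in> mono_maps V q l (insert e S)" "g = restrict f ?W"
        by blast
      then have "f \<in> V \<rightarrow>\<^sub>E {..<q}" "\<forall>e\<in>S. constant_below l f e"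
        by (auto simp: mono_maps_def)
      then show "g \<in> mono_maps ?W q l S"
        using mono_maps_restrict[OF S, of V f q l] f(2) by blast
    qed
  qed (use assms in \<open>simp add: finite_mono_maps\<close>)
  moreover have "card V = Suc (card ?W)"
    using u assms by (metis card_Suc_Diff1 insert_subset)
  ultimately have "mono_prob V q l (insert e S) \<le> mono_prob ?W q l S / real q"
    using assms(2) by (simp add: mono_prob_def divide_right_mono mult.commute)
  also have "mono_prob ?W q l S = mono_prob V q l S"
    by (rule mono_prob_subset[symmetric]) (use assms S in auto)
  finally show ?thesis .
qed

text \<open>The indicator of a qualifying map is the product over the edges of 1 minus the indicator
  of a constant edge. Expanding the product and exchanging the sums gives the formula.\<close>

lemma card_maps_inclusion_exclusion:
  assumes "finite V" "finite E"
  shows "real (card {f \<in> V \<rightarrow>\<^sub>E {..<q}. \<forall>e\<in>E. \<not> constant_below l f e})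
    = (\<Sum>S\<in>Pow E. (-1) ^ card S * real (card (mono_maps V q l S)))"
proof -
  let ?F = "V \<rightarrow>\<^sub>E {..<q}"
  let ?b = "\<lambda>f e. of_bool (constant_below l f e) :: real"
  have F: "finite ?F" using assms by (simp add: finite_PiE)
  have prod: "(\<Prod>e\<in>S. ?b f e) = of_bool (\<forall>e\<in>S. constant_below l f e)" if "S \<subseteq> E" for f S
    using finite_subset[OF that assms(2)] by (induction S) auto
  have expand: "of_bool (\<forall>e\<in>E. \<not> constant_below l f e) = (\<Sum>S\<in>Pow E. (-1) ^ card S * (\<Prod>e\<in>S. ?b f e))" for f
  proof -
    have "of_bool (\<forall>e\<in>E. \<not> constant_below l f e) = (\<Prod>e\<in>E. - ?b f e + 1)"
      using assms(2) by (induction E) auto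
    also have "\<dots> = (\<Sum>S\<in>Pow E. (\<Prod>e\<in>S. - ?b f e) * (\<Prod>e\<in>E-S. 1))"
      by (rule prod_add[OF assms(2)])
    also have "\<dots> = (\<Sum>S\<in>Pow E. (-1) ^ card S * (\<Prod>e\<in>S. ?b f e))"
      by (simp add: prod_uminus)
    finally show ?thesis .
  qed
  have "real (card {f \<in> ?F. \<forall>e\<in>E. \<not> constant_below l f e}) = (\<Sum>f\<in>?F. of_bool (\<forall>e\<in>E. \<not> constant_below l f e))"
    using F by (simp add: of_bool_def sum.If_cases Int_def)
  also have "\<dots> = (\<Sum>S\<in>Pow E. \<Sum>f\<in>?F. (-1) ^ card S * (\<Prod>e\<in>S. ?b f e))"
    unfolding expand by (rule sum.swap)
  also have "\<dots> = (\<Sum>S\<in>Pow E. (-1) ^ card S * real (card (mono_maps V q l S)))"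
  proof (rule sum.cong[OF refl])
    fix S assume "S \<in> Pow E"
    then have "(\<Sum>f\<in>?F. (-1) ^ card S * (\<Prod>e\<in>S. ?b f e))
       = (-1) ^ card S * (\<Sum>f\<in>?F. of_bool (\<forall>e\<in>S. constant_below l f e))"
      by (simp add: prod sum_distrib_left)
    also have "(\<Sum>f\<in>?F. of_bool (\<forall>e\<in>S. constant_below l f e)) = real (card (mono_maps V q l S))"
      using F by (simp add: of_bool_def sum.If_cases Int_def mono_maps_def)
    finally show "(\<Sum>f\<in>?F. (-1) ^ card S * (\<Prod>e\<in>S. ?b f e)) = (-1) ^ card S * real (card (mono_maps V q l S))" .
  qed
  finally show ?thesis .
qed

section \<open>Small edge sets in a regular graph\<close>

text \<open>\<open>x\<close> and \<open>y\<close> may coincide, so the same fact yields the second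
  as well as the third element of \<open>S\<close>.\<close>

lemma ex_third:
  assumes "card S \<ge> 3"
  shows "\<exists>z. z \<in> S \<and> z \<noteq> x \<and> z \<noteq> y"
proof (rule ccontr)
  assume "\<not> ?thesis"
  then have "card S \<le> card {x, y}" by (intro card_mono) auto
  then show False using assms by (auto simp: card_insert_if split: if_splits)
qed

lemma ex_fourth:
  assumes "card S \<ge> 4"
  shows "\<exists>z. z \<in> S \<and> z \<noteq> x \<and> z \<noteq> y \<and> z \<noteq> w"
proof (rule ccontr)
  assume "\<not> ?thesis"
  then have "card S \<le> card {x, y, w}" by (intro card_mono) auto
  then show False using assms by (auto simp: card_insert_if split: if_splits)
qed

text \<open>Edges are two-element sets here instead of symmetric arcs: each edge is then a single
  term of the inclusion-exclusion, and it is itself a vertex set to which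
  \<open>constant_below\<close> applies.\<close>

locale edge_graph =
  fixes V :: "'a set" and E :: "'a set set" and d :: nat
  assumes finite_V: "finite V"
    and edge_subset: "e \<in> E \<Longrightarrow> e \<subseteq> V"
    and edge_card: "e \<in> E \<Longrightarrow> card e = 2"
    and degree: "v \<in> V \<Longrightarrow> card {e \<in> E. v \<in> e} = d"
begin

definition triangle_free :: bool where
  "triangle_free \<longleftrightarrow> (\<forall>S\<subseteq>E. card S = 3 \<longrightarrow> card (\<Union>S) \<noteq> 3)"

text \<open>
  Four edges on four vertices form a 4-cycle only in a triangle-free graph; otherwise a triangle with a
  pendant edge is counted too.
\<close>

definition four_cycles :: "'a set set set" where
  "four_cycles = {S. S \<subseteq> E \<and> card S = 4 \<and> card (\<Union>S) = 4}"

lemma finite_E: "finite E"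
  by (rule finite_subset[of _ "Pow V"]) (use finite_V edge_subset in auto)

lemma finite_edge: "e \<in> E \<Longrightarrow> finite e"
  using edge_card by (metis card.infinite zero_neq_numeral)

lemma edge_nonempty: "e \<in> E \<Longrightarrow> e \<noteq> {}"
  using edge_card by force

lemma edge_subset_eq: "e \<in> E \<Longrightarrow> f \<in> E \<Longrightarrow> e \<subseteq> f \<Longrightarrow> e = f"
  using card_subset_eq[of f e] finite_edge edge_card by auto

lemma Union_subset: "S \<subseteq> E \<Longrightarrow> \<Union>S \<subseteq> V"
  using edge_subset by blast

lemma finite_Union_edges: "S \<subseteq> E \<Longrightarrow> finite (\<Union>S)"
  by (rule finite_subset[OF Union_subset finite_V])

lemma card_Un_disjoint_edges: "e \<in> E \<Longrightarrow> f \<in> E \<Longrightarrow> e \<inter> f = {} \<Longrightarrow> card (e \<union> f) = 4"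
  by (simp add: card_Un_disjoint finite_edge edge_card)

lemma card_Un_meeting_edges:
  assumes "e \<in> E" "f \<in> E" "e \<noteq> f" "e \<inter> f \<noteq> {}"
  shows "card (e \<union> f) = 3"
proof -
  have "e \<inter> f \<subset> e"
    using edge_subset_eq[OF assms(1,2)] assms(3) by blast
  then have "card (e \<inter> f) < 2"
    using psubset_card_mono[OF finite_edge[OF assms(1)]] edge_card[OF assms(1)] by metis
  moreover have "card (e \<inter> f) \<noteq> 0"
    using assms(4) finite_edge[OF assms(1)] by simp
  moreover have "card (e \<union> f) + card (e \<inter> f) = 4"
    using card_Un_Int[of e f] finite_edge edge_card assms(1,2) by simp
  ultimately show ?thesis by linarith
qed

lemma card_Un_meeting:
  assumes "finite A" "g \<in> E" "g \<inter> A \<noteq> {}"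
  shows "card A \<le> card (A \<union> g)" "card (A \<union> g) \<le> Suc (card A)" "\<not> g \<subseteq> A \<Longrightarrow> card (A \<union> g) = Suc (card A)"
proof -
  obtain a where a: "a \<in> g" "a \<in> A" using assms by blast
  then obtain b where g: "g = {a, b}"
    using edge_card[OF assms(2)] by (auto simp: card_2_iff)
  have "A \<union> g = insert b A" using a g by blast
  then show "card A \<le> card (A \<union> g)" "card (A \<union> g) \<le> Suc (card A)" "\<not> g \<subseteq> A \<Longrightarrow> card (A \<union> g) = Suc (card A)"
    using assms(1) a g by (auto simp: card_insert_if)
qed

lemma card_edges_within:
  assumes "S \<subseteq> E" "\<Union>S \<subseteq> U" "finite U"
  shows "card S \<le> card U choose 2"
proof -
  have "card S \<le> card {B. B \<subseteq> U \<and> card B = 2}"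
    by (rule card_mono) (use assms edge_card in auto)
  then show ?thesis
    using n_subsets[OF assms(3)] by simp
qed

text \<open>The cases are the three possible numbers of components. Triangle, path and star share
  the last one, because in all of them a single colour governs the whole cover.\<close>

lemma triple_cases:
  assumes "S \<subseteq> E" "card S = 3"
  obtains (disjoint) e f g where "S = {e, f, g}" "e \<inter> f = {}" "g \<inter> (e \<union> f) = {}" "e \<noteq> f" "card (\<Union>S) = 6"
  | (path_edge) e f g where "S = {e, f, g}" "e \<inter> f \<noteq> {}" "e \<noteq> f" "g \<inter> (e \<union> f) = {}" "card (\<Union>S) = 5"
  | (connected) e f g where "S = {e, f, g}" "e \<inter> f \<noteq> {}" "e \<noteq> f" "(e \<union> f) \<inter> g \<noteq> {}" "card (\<Union>S) \<in> {3, 4}"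
proof -
  obtain e f g where S: "S = {e, f, g}" "e \<noteq> f" "f \<noteq> g" "e \<noteq> g"
    using assms(2) by (auto simp: card_3_iff)
  have E: "e \<in> E" "f \<in> E" "g \<in> E" using S assms by auto
  note fin = finite_edge[OF E(1)] finite_edge[OF E(2)] finite_edge[OF E(3)]
  \<comment> \<open>As soon as two of the three edges meet, they can be renamed to come first; this
    serves all three choices of a meeting pair.\<close>
  have main: thesis if h: "S = {x, y, z}" "x \<noteq> y" "x \<inter> y \<noteq> {}" "x \<in> E" "y \<in> E" "z \<in> E" for x y z
  proof (cases "z \<inter> (x \<union> y) = {}")
    case True
    have "card (z \<union> (x \<union> y)) = 5"
      using True h card_Un_meeting_edges[of x y] by (simp add: card_Un_disjoint finite_edge edge_card)
    then show thesis
      using path_edge[of x y z] h True by (simp add: Un_ac)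
  next
    case False
    have "card (x \<union> y) = 3" using h card_Un_meeting_edges[of x y] by simp
    moreover have "finite (x \<union> y)" using h finite_edge by simp
    ultimately have "card (x \<union> y \<union> z) = 3 \<or> card (x \<union> y \<union> z) = 4"
      using card_Un_meeting(1,2)[of "x \<union> y" z] h(6) False by linarith
    then show thesis
      using connected[of x y z] h False by (auto simp: Un_ac Int_commute)
  qed
  show thesis
  proof (cases "e \<inter> f \<noteq> {} \<or> f \<inter> g \<noteq> {} \<or> e \<inter> g \<noteq> {}")
    case True
    moreover have "S = {f, g, e}" "S = {e, g, f}" using S(1) by auto
    ultimately show thesis
      using main[OF S(1,2) _ E] main[of f g e] main[of e g f] S(3,4) E by blast
  next
    case False
    then have *: "g \<inter> (e \<union> f) = {}" "e \<inter> f = {}" by auto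
    then have "card (g \<union> (e \<union> f)) = 6"
      using E by (simp add: card_Un_disjoint fin edge_card)
    then show thesis
      using disjoint[of e f g] S * by (simp add: Un_ac)
  qed
qed

text \<open>A disconnected triple covers five or six vertices, so a cover of at most four already
  forces connectedness, and the colour spreads through the shared vertices.\<close>

lemma constant_on_connected_triple:
  assumes "S \<subseteq> E" "card S = 3" "card (\<Union>S) \<le> 4"
  shows "(\<forall>e\<in>S. constant_below l h e) \<longleftrightarrow> constant_below l h (\<Union>S)"
  using assms(1,2)
proof (cases rule: triple_cases)
  case (connected e f g)
  then show ?thesis
    using constant_below_merge[of e f l h] constant_below_merge[of "e \<union> f" g l h] by (auto simp: Un_assoc)
qed (use assms in auto)

lemma triangle_freeD:
  assumes triangle_free "{a, b} \<in> E" "{b, c} \<in> E" "{a, c} \<in> E"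
  shows False
proof -
  have "a \<noteq> b" "b \<noteq> c" "a \<noteq> c"
    using assms(2-4) edge_card by force+
  then have "card {{a, b}, {b, c}, {a, c}} = 3" "\<Union>{{a, b}, {b, c}, {a, c}} = {a, b, c}" "card {a, b, c} = 3"
    by (auto simp: doubleton_eq_iff)
  then show False
    using assms unfolding triangle_free_def by (metis empty_subsetI insert_subset)
qed

text \<open>Three vertices carry only three pairs, so three edges covering three vertices are all of
  these pairs.\<close>

lemma triangle_freeI:
  assumes "\<And>a b c. {a, b} \<in> E \<Longrightarrow> {b, c} \<in> E \<Longrightarrow> {a, c} \<in> E \<Longrightarrow> False"
  shows triangle_free
  unfolding triangle_free_def
proof (intro allI impI notI)
  fix S assume S: "S \<subseteq> E" "card S = 3" "card (\<Union>S) = 3"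
  obtain a b c where U: "\<Union>S = {a, b, c}" "a \<noteq> b" "b \<noteq> c" "a \<noteq> c"
    using S(3) by (auto simp: card_3_iff)
  let ?T = "{B. B \<subseteq> {a, b, c} \<and> card B = 2}"
  have "S \<subseteq> ?T" using S(1) U(1) edge_card by blast
  moreover have "card ?T = 3"
    using n_subsets[of "{a, b, c}" 2] U by (simp add: choose_two)
  moreover have "finite ?T" by simp
  ultimately have "S = ?T" using S(2) card_subset_eq by metis
  then have "{a, b} \<in> S" "{b, c} \<in> S" "{a, c} \<in> S" using U by auto
  then show False using assms S(1) by blast
qed

text \<open>Two of the six pairs must be absent. If \<open>{a, b}\<close> is present, the triangles
  on \<open>a, b, c\<close> and on \<open>a, b, x\<close> each lack a further pair, and these two
  differ; if it is absent, the triangle on \<open>b, c, x\<close> lacks another one.\<close>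

lemma card_edges_within_four:
  assumes triangle_free "S \<subseteq> E" "\<Union>S \<subseteq> U" "card U = 4"
  shows "card S \<le> 4"
proof -
  obtain a U' where a: "U = insert a U'" "a \<notin> U'" "card U' = 3"
    using card_eq_SucD[of U 3] assms(4) by auto
  then obtain b c x where U: "U = {a, b, c, x}" and ne: "a \<noteq> b" "a \<noteq> c" "a \<noteq> x" "b \<noteq> c" "b \<noteq> x" "c \<noteq> x"
    by (auto simp: card_3_iff)
  let ?T = "{B. B \<subseteq> U \<and> card B = 2}"
  have finT: "finite ?T" using U by simp
  have T: "card ?T = 6" using n_subsets[of U 2] U assms(4) by (simp add: choose_two)
  have mem: "{a,b} \<in> ?T" "{a,c} \<in> ?T" "{a,x} \<in> ?T" "{b,c} \<in> ?T" "{b,x} \<in> ?T" "{c,x} \<in> ?T"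
    using U ne by auto
  have tri: False if "{p, r} \<in> S" "{r, s} \<in> S" "{p, s} \<in> S" for p r s
    using triangle_freeD[OF assms(1)] that assms(2) by blast
  have "\<exists>m m'. m \<in> ?T \<and> m' \<in> ?T \<and> m \<noteq> m' \<and> m \<notin> S \<and> m' \<notin> S"
  proof (cases "{a, b} \<in> S")
    case True
    obtain m where m: "m = {a, c} \<or> m = {b, c}" "m \<notin> S"
      using tri[of a b c] True by blast
    obtain m' where m': "m' = {a, x} \<or> m' = {b, x}" "m' \<notin> S"
      using tri[of a b x] True by blast
    have "m \<noteq> m'" using m(1) m'(1) ne by (metis doubleton_eq_iff)
    moreover have "m \<in> ?T" using m(1) mem by presburger
    moreover have "m' \<in> ?T" using m'(1) mem by presburger
    ultimately show ?thesis using m(2) m'(2) by blast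
  next
    case False
    obtain m where m: "m = {b, c} \<or> m = {c, x} \<or> m = {b, x}" "m \<notin> S"
      using tri[of b c x] by blast
    have "m \<noteq> {a, b}" using m(1) ne by (metis doubleton_eq_iff)
    moreover have "m \<in> ?T" using m(1) mem by presburger
    ultimately show ?thesis using m(2) False mem(1) by blast
  qed
  then obtain m m' where m: "m \<in> ?T" "m' \<in> ?T" "m \<noteq> m'" "m \<notin> S" "m' \<notin> S" by blast
  have "S \<subseteq> ?T - {m, m'}"
    using m assms(2,3) edge_card by blast
  then have "card S \<le> card (?T - {m, m'})"
    by (rule card_mono[rotated]) (use finT in blast)
  also have "\<dots> = card ?T - card {m, m'}"
    by (rule card_Diff_subset) (use m in auto)
  finally show ?thesis using T m(3) by simp
qed

section \<open>Exact probabilities of small edge sets and upper bounds for larger ones\<close>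

context
  fixes q l :: nat
  assumes q: "l \<le> q" "q > 0"
begin

lemma mono_prob_edge: "e \<in> E \<Longrightarrow> mono_prob V q l {e} = real l / real q ^ 2"
  using mono_prob_single[OF finite_V edge_subset edge_nonempty q] by (simp add: edge_card)

text \<open>The exponent of \<open>l\<close> is the number of components: two disjoint edges cover
  four vertices, two meeting edges cover three.\<close>

lemma mono_prob_two_edges:
  assumes "S \<subseteq> E" "card S = 2"
  shows "card (\<Union>S) \<in> {3, 4}"
    "mono_prob V q l S = real l ^ (card (\<Union>S) - 2) / real q ^ card (\<Union>S)"
proof -
  obtain e f where S: "S = {e, f}" "e \<noteq> f" using assms by (auto simp: card_2_iff)
  have E: "e \<in> E" "f \<in> E" using S assms by auto
  have "card (\<Union>S) \<in> {3, 4} \<and> mono_prob V q l S = real l ^ (card (\<Union>S) - 2) / real q ^ card (\<Union>S)"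
  proof (cases "e \<inter> f = {}")
    case True
    have "mono_prob V q l {e, f} = real l / real q ^ 2 * (real l / real q ^ 2)"
      using mono_prob_disjoint[OF finite_V edge_subset[OF E(1)] edge_nonempty[OF E(1)] q, of "{f}"]
        True edge_subset[OF E(2)] E by (auto simp: mono_prob_edge edge_card)
    moreover have "card (\<Union>S) = 4"
      using True E S card_Un_disjoint_edges by simp
    ultimately show ?thesis
      using S by (simp add: power2_eq_square power4_eq_xxxx)
  next
    case False
    then have c: "card (e \<union> f) = 3" using E S card_Un_meeting_edges by simp
    have "mono_prob V q l {e \<union> f} = real l / real q ^ 3"
      using mono_prob_single[OF finite_V _ _ q, of "e \<union> f"] E edge_subset edge_nonempty c by auto
    then show ?thesis
      using S c mono_prob_merge[OF False, of V q l "{}"] by simp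
  qed
  then show "card (\<Union>S) \<in> {3, 4}"
    "mono_prob V q l S = real l ^ (card (\<Union>S) - 2) / real q ^ card (\<Union>S)" by auto
qed

text \<open>For a forest the number of components is the cover size minus 3. The triangle has cover
  size 3 but one component, and \<open>max 1\<close> accounts for it.\<close>

lemma mono_prob_three_edges:
  assumes "S \<subseteq> E" "card S = 3"
  shows "card (\<Union>S) \<in> {3, 4, 5, 6}"
    "mono_prob V q l S = real l ^ max 1 (card (\<Union>S) - 3) / real q ^ card (\<Union>S)"
proof -
  have "card (\<Union>S) \<in> {3, 4, 5, 6} \<and>
    mono_prob V q l S = real l ^ max 1 (card (\<Union>S) - 3) / real q ^ card (\<Union>S)"
    using assms
  proof (cases rule: triple_cases)
    case (disjoint e f g)
    have E: "e \<in> E" "f \<in> E" "g \<in> E" using disjoint assms by auto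
    have "mono_prob V q l (insert g {e, f}) = real l / real q ^ 2 * mono_prob V q l {e, f}"
      using mono_prob_disjoint[OF finite_V edge_subset[OF E(3)] edge_nonempty[OF E(3)] q, of "{e, f}"]
        disjoint edge_subset[OF E(1)] edge_subset[OF E(2)] edge_card[OF E(3)] by auto
    moreover have "mono_prob V q l {e, f} = real l ^ 2 / real q ^ 4"
      using mono_prob_two_edges[of "{e, f}"] card_Un_disjoint_edges[of e f] disjoint E by simp
    moreover have "S = insert g {e, f}" using disjoint by auto
    ultimately show ?thesis
      using disjoint(5) by (simp add: power2_eq_square eval_nat_numeral)
  next
    case (path_edge e f g)
    have E: "e \<in> E" "f \<in> E" "g \<in> E" using path_edge assms by auto
    have "mono_prob V q l (insert g {e, f}) = real l / real q ^ 2 * mono_prob V q l {e, f}"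
      using mono_prob_disjoint[OF finite_V edge_subset[OF E(3)] edge_nonempty[OF E(3)] q, of "{e, f}"]
        path_edge edge_subset[OF E(1)] edge_subset[OF E(2)] edge_card[OF E(3)] by auto
    moreover have "mono_prob V q l {e, f} = real l / real q ^ 3"
      using mono_prob_two_edges[of "{e, f}"] card_Un_meeting_edges[of e f] path_edge E by simp
    moreover have "S = insert g {e, f}" using path_edge by auto
    ultimately show ?thesis
      using path_edge(5) by (simp add: power2_eq_square eval_nat_numeral)
  next
    case (connected e f g)
    have "mono_prob V q l S = mono_prob V q l {\<Union>S}"
    proof (rule mono_prob_cong)
      have "card (\<Union>S) \<le> 4" using connected(5) by auto
      then show "(\<forall>e\<in>S. constant_below l h e) \<longleftrightarrow> (\<forall>e\<in>{\<Union>S}. constant_below l h e)" for h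
        using constant_on_connected_triple[OF assms] by simp
    qed
    also have "\<dots> = real l / real q ^ card (\<Union>S)"
    proof (rule mono_prob_single[OF finite_V Union_subset[OF assms(1)] _ q])
      have "card (\<Union>S) \<noteq> 0" using connected(5) by auto
      then show "\<Union>S \<noteq> {}" by (metis card.empty)
    qed
    finally show ?thesis
      using connected(5) by (auto simp: max_def)
  qed
  then show "card (\<Union>S) \<in> {3, 4, 5, 6}"
    "mono_prob V q l S = real l ^ max 1 (card (\<Union>S) - 3) / real q ^ card (\<Union>S)" by auto
qed

text \<open>The first edge costs \<open>l / q ^ 2\<close>, and each later edge reaches a vertex
  outside the union of the earlier ones and so costs another factor \<open>q\<close>.\<close>

lemma mono_prob_chain3:
  assumes "S \<subseteq> E" "e1 \<in> S" "e2 \<in> S" "e3 \<in> S" "e1 \<noteq> e2" "\<not> e3 \<subseteq> e1 \<union> e2"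
  shows "mono_prob V q l {e3, e2, e1} \<le> real l / real q ^ 4"
proof -
  have E: "e1 \<in> E" "e2 \<in> E" "e3 \<in> E" using assms by auto
  have "\<not> e2 \<subseteq> e1" using edge_subset_eq[OF E(2,1)] assms(5) by blast
  then have "mono_prob V q l {e2, e1} \<le> mono_prob V q l {e1} / real q"
    by (intro mono_prob_extend[OF finite_V q(2)])
      (use E edge_card edge_subset in auto)
  then have "mono_prob V q l {e2, e1} \<le> real l / real q ^ 3"
    by (simp add: mono_prob_edge[OF E(1)] eval_nat_numeral mult_ac)
  moreover have "mono_prob V q l {e3, e2, e1} \<le> mono_prob V q l {e2, e1} / real q"
    by (rule mono_prob_extend[OF finite_V q(2)])
      (use E edge_card edge_subset assms in auto)
  ultimately have "mono_prob V q l {e3, e2, e1} \<le> real l / real q ^ 3 / real q"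
    by (meson divide_right_mono of_nat_0_le_iff order_trans)
  then show ?thesis
    by (simp add: eval_nat_numeral mult_ac)
qed

lemma mono_prob_chain4:
  assumes "S \<subseteq> E" "e1 \<in> S" "e2 \<in> S" "e3 \<in> S" "e4 \<in> S" "e1 \<noteq> e2" "\<not> e3 \<subseteq> e1 \<union> e2"
    "\<not> e4 \<subseteq> e1 \<union> e2 \<union> e3"
  shows "mono_prob V q l S \<le> real l / real q ^ 5"
proof -
  have E: "e1 \<in> E" "e2 \<in> E" "e3 \<in> E" "e4 \<in> E" using assms by auto
  have "mono_prob V q l S \<le> mono_prob V q l {e4, e3, e2, e1}"
    by (rule mono_prob_antimono[OF finite_V]) (use assms in auto)
  also have "\<dots> \<le> mono_prob V q l {e3, e2, e1} / real q"
    by (rule mono_prob_extend[OF finite_V q(2)])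
      (use E edge_card edge_subset assms in auto)
  also have "\<dots> \<le> real l / real q ^ 4 / real q"
    by (intro divide_right_mono mono_prob_chain3[OF assms(1-4,6,7)]) auto
  finally show ?thesis
    by (simp add: eval_nat_numeral mult_ac)
qed

text \<open>It suffices to order three members of \<open>S\<close> so that each brings a new vertex.
  This fails only if two meeting edges already cover everything, and then \<open>S\<close> consists
  of the three pairs on three vertices.\<close>

lemma mono_prob_ge_three:
  assumes S: "S \<subseteq> E" "card S \<ge> 3" "\<not> (card S = 3 \<and> card (\<Union>S) = 3)"
  shows "mono_prob V q l S \<le> real l / real q ^ 4"
proof -
  have le: ?thesis if "e1 \<in> S" "e2 \<in> S" "e3 \<in> S" "e1 \<noteq> e2" "\<not> e3 \<subseteq> e1 \<union> e2" for e1 e2 e3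
    using mono_prob_chain3[OF S(1) that] mono_prob_antimono[OF finite_V, of "{e3, e2, e1}" S q l] that
    by force
  obtain e where e: "e \<in> S" using ex_third[OF S(2)] by blast
  obtain f where f: "f \<in> S" "f \<noteq> e" using ex_third[OF S(2), of e e] by blast
  obtain g where g: "g \<in> S" "g \<noteq> e" "g \<noteq> f" using ex_third[OF S(2), of e f] by blast
  have E: "e \<in> E" "f \<in> E" "g \<in> E" using e f g S by auto
  show ?thesis
  proof (cases "\<exists>h\<in>S. \<not> h \<subseteq> e \<union> f")
    case True
    then show ?thesis using le[of e f] e f by blast
  next
    case False
    show ?thesis
    proof (cases "e \<inter> f = {}")
      case True
      \<comment> \<open>When \<open>e\<close> and \<open>f\<close> are disjoint and contain all
        other edges in their union, \<open>f\<close> is taken last: inside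
        \<open>e \<union> g\<close> it would have to equal \<open>g\<close>.\<close>
      have "\<not> f \<subseteq> e \<union> g"
        using True edge_subset_eq[of f g] E g by blast
      then show ?thesis using le[of e g f] e f g by blast
    next
      case inter: False
      have c: "card (e \<union> f) = 3" using card_Un_meeting_edges[of e f] E f inter by auto
      have U: "\<Union>S = e \<union> f" using False e f by blast
      have "card S \<le> 3 choose 2"
        using card_edges_within[OF S(1), of "e \<union> f"] c U finite_edge E by simp
      then have "card S = 3" using S(2) by (simp add: choose_two)
      then show ?thesis using S(3) U c by simp
    qed
  qed
qed

text \<open>Four members are sought of which each brings a new vertex. Given two meeting edges,
  triangle-freeness keeps every third edge out of their union; the fourth one needs care only if the
  third meets them. If no two edges meet, any four edges will do.\<close>

lemma mono_prob_ge_four: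
  assumes tf: triangle_free and S: "S \<subseteq> E" "card S \<ge> 4" "S \<notin> four_cycles"
  shows "mono_prob V q l S \<le> real l / real q ^ 5"
proof (cases "\<exists>e\<in>S. \<exists>f\<in>S. e \<noteq> f \<and> e \<inter> f \<noteq> {}")
  case True
  then obtain e f where ef: "e \<in> S" "f \<in> S" "e \<noteq> f" "e \<inter> f \<noteq> {}" by blast
  have E: "e \<in> E" "f \<in> E" using ef S by auto
  have c: "card (e \<union> f) = 3" using card_Un_meeting_edges E ef by simp
  have out: "\<not> g \<subseteq> e \<union> f" if g: "g \<in> S" "g \<noteq> e" "g \<noteq> f" for g
  proof
    assume "g \<subseteq> e \<union> f"
    then have "\<Union>{e, f, g} = e \<union> f" by blast
    moreover have "card {e, f, g} = 3" "{e, f, g} \<subseteq> E" using g ef S by auto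
    ultimately show False using tf c unfolding triangle_free_def by metis
  qed
  show ?thesis
  proof (cases "\<exists>g\<in>S. g \<noteq> e \<and> g \<noteq> f \<and> g \<inter> (e \<union> f) \<noteq> {}")
    case True
    then obtain g where g: "g \<in> S" "g \<noteq> e" "g \<noteq> f" "g \<inter> (e \<union> f) \<noteq> {}" by blast
    let ?U = "e \<union> f \<union> g"
    have "card ?U = 4"
      using card_Un_meeting(3)[of "e \<union> f" g] g out[of g] c S E finite_edge by auto
    \<comment> \<open>If all edges stayed inside the four vertices of \<open>?U\<close>, there would
      be exactly four of them covering exactly \<open>?U\<close>, and \<open>S\<close> would belong
      to \<open>four_cycles\<close>.\<close>
    have "\<exists>h\<in>S. \<not> h \<subseteq> ?U"
    proof (rule ccontr)
      assume "\<not> ?thesis"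
      then have U: "\<Union>S = ?U" using ef g by blast
      then have "card S \<le> 4"
        using card_edges_within_four[OF tf S(1), of ?U] \<open>card ?U = 4\<close> by simp
      then show False
        using S U \<open>card ?U = 4\<close> by (simp add: four_cycles_def)
    qed
    then obtain h where h: "h \<in> S" "\<not> h \<subseteq> ?U" by blast
    show ?thesis
      by (rule mono_prob_chain4[OF S(1) ef(1,2) g(1) h(1) ef(3) out[OF g(1-3)] h(2)])
  next
    case False
    obtain g where g: "g \<in> S" "g \<noteq> e" "g \<noteq> f" using ex_fourth[OF S(2), of e f f] by blast
    obtain h where h: "h \<in> S" "h \<noteq> e" "h \<noteq> f" "h \<noteq> g" using ex_fourth[OF S(2), of e f g] by blast
    have "h \<inter> (e \<union> f) = {}" using False h by blast
    moreover have "\<not> h \<subseteq> g" using edge_subset_eq[of h g] h g S(1) by blast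
    ultimately have "\<not> h \<subseteq> e \<union> f \<union> g" by blast
    then show ?thesis
      by (rule mono_prob_chain4[OF S(1) ef(1,2) g(1) h(1) ef(3) out[OF g]])
  qed
next
  case False
  obtain e where e: "e \<in> S" using ex_fourth[OF S(2)] by blast
  obtain f where f: "f \<in> S" "f \<noteq> e" using ex_fourth[OF S(2), of e e e] by blast
  obtain g where g: "g \<in> S" "g \<noteq> e" "g \<noteq> f" using ex_fourth[OF S(2), of e f f] by blast
  obtain h where h: "h \<in> S" "h \<noteq> e" "h \<noteq> f" "h \<noteq> g" using ex_fourth[OF S(2), of e f g] by blast
  have "g \<inter> e = {}" "g \<inter> f = {}" "h \<inter> e = {}" "h \<inter> f = {}" "h \<inter> g = {}"
    using False e f g h by metis+
  moreover have "g \<noteq> {}" "h \<noteq> {}" using edge_nonempty g h S by blast+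
  ultimately have "\<not> g \<subseteq> e \<union> f" "\<not> h \<subseteq> e \<union> f \<union> g" by blast+
  then show ?thesis
    using mono_prob_chain4[OF S(1) e f(1) g(1) h(1)] f(2) by metis
qed

text \<open>Any three of the four edges already connect all four vertices, so the last edge holds
  automatically and costs nothing. Compared with a chain of four edges this gains a factor
  \<open>q\<close>.\<close>

lemma mono_prob_four_cycle:
  assumes tf: triangle_free and S: "S \<in> four_cycles"
  shows "mono_prob V q l S = real l / real q ^ 4"
proof -
  have S: "S \<subseteq> E" "card S = 4" "card (\<Union>S) = 4"
    using S by (auto simp: four_cycles_def)
  have "S \<noteq> {}" using S(2) by force
  then obtain e where e: "e \<in> S" by blast
  let ?T = "S - {e}"
  have T: "?T \<subseteq> E" "card ?T = 3" using e S by (auto simp: card_Diff_singleton)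
  have sub: "\<Union>?T \<subseteq> \<Union>S" by blast
  have le: "card (\<Union>?T) \<le> 4" using card_mono[OF finite_Union_edges[OF S(1)] sub] S(3) by simp
  have "card (\<Union>?T) \<noteq> 3" using tf T unfolding triangle_free_def by blast
  then have "card (\<Union>?T) = 4" using mono_prob_three_edges(1)[OF T] le by auto
  then have U: "\<Union>?T = \<Union>S" using card_subset_eq[OF finite_Union_edges[OF S(1)] sub] S(3) by simp
  have "mono_prob V q l S = mono_prob V q l {\<Union>S}"
  proof (rule mono_prob_cong)
    fix h :: "'a \<Rightarrow> nat"
    have "(\<forall>e\<in>S. constant_below l h e) \<longrightarrow> (\<forall>e\<in>?T. constant_below l h e)" by blast
    moreover have "constant_below l h (\<Union>S) \<longrightarrow> (\<forall>e\<in>S. constant_below l h e)"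
      using constant_below_mono by blast
    ultimately show "(\<forall>e\<in>S. constant_below l h e) \<longleftrightarrow> (\<forall>e\<in>{\<Union>S}. constant_below l h e)"
      using constant_on_connected_triple[OF T le, of l h] U by auto
  qed
  also have "\<dots> = real l / real q ^ card (\<Union>S)"
  proof (rule mono_prob_single[OF finite_V Union_subset[OF S(1)] _ q])
    show "\<Union>S \<noteq> {}" using S(3) by (metis card.empty zero_neq_numeral)
  qed
  finally show ?thesis using S by simp
qed

end

end

section \<open>Covered vertices and four-cycles\<close>

context edge_graph
begin

definition neighbours :: "'a \<Rightarrow> 'a set" where
  "neighbours v = {w. {v, w} \<in> E}"

definition arc_pairs :: "('a \<times> 'a) set" where
  "arc_pairs = {(u, v). {u, v} \<in> E}"

text \<open>Every walk \<open>a, u, v, b\<close> closes up; the degenerate choices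
  \<open>a = v\<close> and \<open>b = u\<close> hold trivially. Together with
  \<open>triangle_free\<close> this characterises the disjoint unions of copies of K_{d,d} among the
  d-regular graphs.\<close>

definition biclique_closed :: bool where
  "biclique_closed \<longleftrightarrow> (\<forall>u v a b. {u, v} \<in> E \<longrightarrow> {u, a} \<in> E \<longrightarrow> {v, b} \<in> E \<longrightarrow> {a, b} \<in> E)"

lemma edge_distinct: "{u, v} \<in> E \<Longrightarrow> u \<noteq> v"
  using edge_card by force

lemma edge_as_pair: "e \<in> E \<Longrightarrow> \<exists>x y. e = {x, y} \<and> x \<noteq> y"
  using edge_card by (simp add: card_2_iff)

lemma edge_in_V: "{u, v} \<in> E \<Longrightarrow> u \<in> V \<and> v \<in> V"
  using edge_subset by blast

lemma neighbours_subset: "neighbours v \<subseteq> V"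
  using edge_in_V by (auto simp: neighbours_def)

lemma finite_neighbours: "finite (neighbours v)"
  using neighbours_subset finite_V finite_subset by metis

lemma card_neighbours:
  assumes "v \<in> V"
  shows "card (neighbours v) = d"
proof -
  have "bij_betw (\<lambda>w. {v, w}) (neighbours v) {e \<in> E. v \<in> e}"
  proof (rule bij_betw_imageI)
    show "inj_on (\<lambda>w. {v, w}) (neighbours v)"
      by (auto simp: inj_on_def doubleton_eq_iff)
    show "(\<lambda>w. {v, w}) ` neighbours v = {e \<in> E. v \<in> e}"
    proof
      show "{e \<in> E. v \<in> e} \<subseteq> (\<lambda>w. {v, w}) ` neighbours v"
      proof
        fix e assume e: "e \<in> {e \<in> E. v \<in> e}"
        then obtain x y where "e = {x, y}" using edge_as_pair by blast
        then obtain w where "e = {v, w}" using e by blast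
        then show "e \<in> (\<lambda>w. {v, w}) ` neighbours v"
          using e by (auto simp: neighbours_def)
      qed
    qed (auto simp: neighbours_def)
  qed
  then show ?thesis
    using degree[OF assms] bij_betw_same_card by metis
qed

lemma handshake: "2 * card E = card V * d"
proof -
  have "(\<Sum>v\<in>V. card {e \<in> E. v \<in> e}) = 2 * card E"
  proof (rule sum_multicount[OF finite_V finite_E], rule ballI)
    fix e assume e: "e \<in> E"
    then have "{v \<in> V. v \<in> e} = e" using edge_subset by blast
    then show "card {v \<in> V. v \<in> e} = 2" using edge_card[OF e] by simp
  qed
  then show ?thesis using degree by simp
qed

lemma card_edges_avoiding_pair:
  assumes "u \<in> V" "v \<in> V"
  shows "card {e \<in> E. u \<notin> e \<and> v \<notin> e}
    = (if u = v then card E - d else if v \<in> neighbours u then card E - (2 * d - 1) else card E - 2 * d)"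
proof -
  let ?A = "{e \<in> E. u \<in> e}" and ?B = "{e \<in> E. v \<in> e}"
  have fin: "finite ?A" "finite ?B" using finite_E by auto
  have "{e \<in> E. u \<notin> e \<and> v \<notin> e} = E - (?A \<union> ?B)" by auto
  then have *: "card {e \<in> E. u \<notin> e \<and> v \<notin> e} = card E - card (?A \<union> ?B)"
    using card_Diff_subset[of "?A \<union> ?B" E] fin by auto
  show ?thesis
  proof (cases "u = v")
    case True
    then show ?thesis using * degree[OF assms(1)] by simp
  next
    case False
    have AB: "card (?A \<union> ?B) = 2 * d - card (?A \<inter> ?B)"
      using card_Un_Int[OF fin] degree[OF assms(1)] degree[OF assms(2)] by simp
    have "e = {u, v}" if "e \<in> ?A \<inter> ?B" for e
    proof -
      have "finite e" "card e = 2" using that finite_edge edge_card by auto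
      moreover have "{u, v} \<subseteq> e" "card {u, v} = 2" using that False by auto
      ultimately show ?thesis using card_subset_eq by metis
    qed
    then have "?A \<inter> ?B = (if v \<in> neighbours u then {{u, v}} else {})"
      by (auto simp: neighbours_def)
    then have "card (?A \<inter> ?B) = (if v \<in> neighbours u then 1 else 0)"
      by simp
    then show ?thesis using * AB False by simp
  qed
qed

section \<open>Moments of the number of uncovered vertices\<close>

lemma card_subfamilies: "card {S. S \<subseteq> E \<and> card S = j} = card E choose j"
  by (rule n_subsets[OF finite_E])

lemma finite_subfamilies: "finite {S. S \<subseteq> E \<and> P S}"
  using finite_E by simp

lemma card_subfamilies_avoiding:
  "card {S \<in> {S. S \<subseteq> E \<and> card S = j}. u \<notin> \<Union>S \<and> v \<notin> \<Union>S} = card {e \<in> E. u \<notin> e \<and> v \<notin> e} choose j"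
proof -
  have "{S \<in> {S. S \<subseteq> E \<and> card S = j}. u \<notin> \<Union>S \<and> v \<notin> \<Union>S}
     = {S. S \<subseteq> {e \<in> E. u \<notin> e \<and> v \<notin> e} \<and> card S = j}"
    by blast
  then show ?thesis using n_subsets[of "{e \<in> E. u \<notin> e \<and> v \<notin> e}" j] finite_E by simp
qed

text \<open>Double counting of a vertex together with a family that misses it. Uncovered vertices
  are easier to count than covered ones: missing \<open>v\<close> just means choosing from the
  \<open>card E - d\<close> edges not at \<open>v\<close>.\<close>

lemma sum_uncovered:
  "(\<Sum>S | S \<subseteq> E \<and> card S = j. card (V - \<Union>S)) = card V * (card E - d choose j)"
proof -
  have "(\<Sum>S | S \<subseteq> E \<and> card S = j. card {v \<in> V. v \<notin> \<Union>S}) = (\<Sum>v\<in>V. (card E - d choose j))"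
  proof (rule sum_multicount_gen[OF finite_subfamilies finite_V], rule ballI)
    fix v assume "v \<in> V"
    then show "card {S \<in> {S. S \<subseteq> E \<and> card S = j}. v \<notin> \<Union>S} = card E - d choose j"
      using card_subfamilies_avoiding[of j v v] card_edges_avoiding_pair[of v v] by simp
  qed
  then show ?thesis
    by (simp add: set_diff_eq)
qed

text \<open>The square counts ordered pairs of uncovered vertices. For a fixed first vertex the
  second one is the same vertex, one of its \<open>d\<close> neighbours, or one of the
  \<open>card V - 1 - d\<close> others; an adjacent pair shares one edge, whence
  \<open>2 * d - 1\<close>.\<close>

lemma sum_uncovered_squared:
  "(\<Sum>S | S \<subseteq> E \<and> card S = j. (card (V - \<Union>S))\<^sup>2)
     = card V * ((card E - d choose j) + d * (card E - (2 * d - 1) choose j)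
         + (card V - 1 - d) * (card E - 2 * d choose j))"
proof -
  let ?k = "\<lambda>u v. card {e \<in> E. u \<notin> e \<and> v \<notin> e} choose j"
  have sq: "(card (V - \<Union>S))\<^sup>2 = card {p \<in> V \<times> V. fst p \<notin> \<Union>S \<and> snd p \<notin> \<Union>S}" for S
  proof -
    have "{p \<in> V \<times> V. fst p \<notin> \<Union>S \<and> snd p \<notin> \<Union>S} = (V - \<Union>S) \<times> (V - \<Union>S)"
      by auto
    then show ?thesis by (simp add: card_cartesian_product power2_eq_square)
  qed
  have "(\<Sum>S | S \<subseteq> E \<and> card S = j. card {p \<in> V \<times> V. fst p \<notin> \<Union>S \<and> snd p \<notin> \<Union>S})
     = (\<Sum>p\<in>V \<times> V. ?k (fst p) (snd p))"
    by (rule sum_multicount_gen[OF finite_subfamilies])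
      (use finite_V card_subfamilies_avoiding in auto)
  also have "\<dots> = (\<Sum>u\<in>V. \<Sum>v\<in>V. ?k u v)"
    by (simp add: sum.cartesian_product split_def)
  also have "\<dots> = (\<Sum>u\<in>V. (card E - d choose j) + d * (card E - (2 * d - 1) choose j)
         + (card V - 1 - d) * (card E - 2 * d choose j))"
  proof (rule sum.cong[OF refl])
    fix u assume u: "u \<in> V"
    let ?N = "neighbours u" and ?R = "V - insert u (neighbours u)"
    have uN: "u \<notin> ?N" using edge_distinct[of u u] by (auto simp: neighbours_def)
    have V: "V = insert u (?N \<union> ?R)" using u neighbours_subset by blast
    have cR: "card ?R = card V - 1 - d"
    proof -
      have "card (insert u ?N) = Suc d" using uN finite_neighbours card_neighbours[OF u] by simp
      moreover have "card ?R = card V - card (insert u ?N)"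
        by (rule card_Diff_subset) (use u neighbours_subset finite_neighbours in auto)
      ultimately show ?thesis by simp
    qed
    have "(\<Sum>v\<in>V. ?k u v) = (\<Sum>v\<in>insert u (?N \<union> ?R). ?k u v)" using V by simp
    also have "\<dots> = ?k u u + (\<Sum>v\<in>?N \<union> ?R. ?k u v)"
      by (rule sum.insert) (use finite_V finite_neighbours uN in auto)
    also have "(\<Sum>v\<in>?N \<union> ?R. ?k u v) = (\<Sum>v\<in>?N. ?k u v) + (\<Sum>v\<in>?R. ?k u v)"
      by (rule sum.union_disjoint) (use finite_V finite_neighbours in auto)
    also have "(\<Sum>v\<in>?N. ?k u v) = (\<Sum>v\<in>?N. card E - (2 * d - 1) choose j)"
    proof (rule sum.cong[OF refl])
      fix v assume v: "v \<in> ?N"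
      then have "v \<in> V" "v \<noteq> u" using neighbours_subset uN by auto
      then show "?k u v = card E - (2 * d - 1) choose j"
        using card_edges_avoiding_pair[OF u, of v] v by simp
    qed
    also have "(\<Sum>v\<in>?R. ?k u v) = (\<Sum>v\<in>?R. card E - 2 * d choose j)"
    proof (rule sum.cong[OF refl])
      fix v assume "v \<in> ?R"
      then show "?k u v = card E - 2 * d choose j"
        using card_edges_avoiding_pair[OF u, of v] by auto
    qed
    also have "?k u u = card E - d choose j"
      using card_edges_avoiding_pair[OF u u] by simp
    finally show "(\<Sum>v\<in>V. ?k u v) = (card E - d choose j) + d * (card E - (2 * d - 1) choose j)
         + (card V - 1 - d) * (card E - 2 * d choose j)"
      using cR card_neighbours[OF u] by simp
  qed
  finally show ?thesis
    unfolding sq by simp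
qed

lemma card_uncovered:
  assumes "S \<subseteq> E"
  shows "real (card (V - \<Union>S)) = real (card V) - real (card (\<Union>S))"
  using card_Diff_subset[OF finite_Union_edges[OF assms] Union_subset[OF assms]]
    card_mono[OF finite_V Union_subset[OF assms]] by simp

end

lemma quadratic_interpolation:
  fixes h :: "nat \<Rightarrow> real" and t :: real
  obtains \<alpha> \<beta> \<gamma> where "\<And>m. m \<in> {c, c + 1, c + 2} \<Longrightarrow> h m = \<alpha> + \<beta> * (t - real m) + \<gamma> * (t - real m)\<^sup>2"
proof -
  \<comment> \<open>Newton's forward form with first difference \<open>D1\<close> and half the
    second difference \<open>D2\<close>, rewritten from the variable \<open>m - c\<close> to
    \<open>t - m\<close>, which will be the number of uncovered vertices.\<close>
  define D1 where "D1 = h (c + 1) - h c"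
  define D2 where "D2 = (h (c + 2) - 2 * h (c + 1) + h c) / 2"
  define s where "s = t - real c"
  have "h m = (h c + D1 * s + D2 * (s * (s - 1))) + (- D1 - D2 * (2 * s - 1)) * (t - real m) + D2 * (t - real m)\<^sup>2"
    if "m \<in> {c, c + 1, c + 2}" for m
    using that by (auto simp: D1_def D2_def s_def power2_eq_square field_simps)
  then show thesis by (rule that)
qed

text \<open>
  A vertex pair is avoided by a number of edges that depends only on whether the pair is equal, adjacent or
  neither. Hence the first two moments of the number of covered vertices agree in both graphs,
  and any weight supported on three consecutive cover sizes is a quadratic polynomial in it.
\<close>

lemma sum_cover_eq:
  fixes h :: "nat \<Rightarrow> real"
  assumes G: "edge_graph V E d" and K: "edge_graph V' E' d" and n: "card V = card V'"
    and cover: "\<And>S. S \<subseteq> E \<Longrightarrow> card S = j \<Longrightarrow> card (\<Union>S) \<in> {c, c + 1, c + 2}"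
    and cover': "\<And>S. S \<subseteq> E' \<Longrightarrow> card S = j \<Longrightarrow> card (\<Union>S) \<in> {c, c + 1, c + 2}"
  shows "(\<Sum>S | S \<subseteq> E \<and> card S = j. h (card (\<Union>S))) = (\<Sum>S | S \<subseteq> E' \<and> card S = j. h (card (\<Union>S)))"
proof -
  obtain \<alpha> \<beta> \<gamma> where h: "\<And>m. m \<in> {c, c + 1, c + 2} \<Longrightarrow>
      h m = \<alpha> + \<beta> * (real (card V) - real m) + \<gamma> * (real (card V) - real m)\<^sup>2"
    using quadratic_interpolation[of c h "real (card V)"] by blast
  \<comment> \<open>Proved for any d-regular graph of this order and applied to both. The two
    moments on the right depend only on \<open>card V\<close>, \<open>card E\<close> and
    \<open>d\<close>.\<close>
  have expand: "(\<Sum>S | S \<subseteq> F \<and> card S = j. h (card (\<Union>S)))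
     = \<alpha> * real (card F choose j) + \<beta> * real (\<Sum>S | S \<subseteq> F \<and> card S = j. card (W - \<Union>S))
       + \<gamma> * real (\<Sum>S | S \<subseteq> F \<and> card S = j. (card (W - \<Union>S))\<^sup>2)"
    if F: "edge_graph W F d" "card W = card V"
      and cov: "\<And>S. S \<subseteq> F \<Longrightarrow> card S = j \<Longrightarrow> card (\<Union>S) \<in> {c, c + 1, c + 2}" for W F
  proof -
    interpret F: edge_graph W F d by fact
    have "(\<Sum>S | S \<subseteq> F \<and> card S = j. h (card (\<Union>S)))
      = (\<Sum>S | S \<subseteq> F \<and> card S = j. \<alpha> + \<beta> * real (card (W - \<Union>S)) + \<gamma> * real ((card (W - \<Union>S))\<^sup>2))"
    proof (rule sum.cong[OF refl])
      fix S assume "S \<in> {S. S \<subseteq> F \<and> card S = j}"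
      then have S: "S \<subseteq> F" "card S = j" by auto
      show "h (card (\<Union>S)) = \<alpha> + \<beta> * real (card (W - \<Union>S)) + \<gamma> * real ((card (W - \<Union>S))\<^sup>2)"
        using h[OF cov[OF S]] F.card_uncovered[OF S(1)] F(2) by simp
    qed
    also have "\<dots> = \<alpha> * real (card F choose j) + \<beta> * real (\<Sum>S | S \<subseteq> F \<and> card S = j. card (W - \<Union>S))
       + \<gamma> * real (\<Sum>S | S \<subseteq> F \<and> card S = j. (card (W - \<Union>S))\<^sup>2)"
      by (simp add: sum.distrib sum_distrib_left F.card_subfamilies mult.commute)
    finally show ?thesis .
  qed
  have "2 * card E = 2 * card E'"
    using edge_graph.handshake[OF G] edge_graph.handshake[OF K] n by simp
  then have "card E = card E'" by simp
  moreover note expand[OF G refl, OF cover] expand[OF K n[symmetric], OF cover']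
  ultimately show ?thesis
    unfolding
      edge_graph.sum_uncovered[OF G] edge_graph.sum_uncovered[OF K]
      edge_graph.sum_uncovered_squared[OF G] edge_graph.sum_uncovered_squared[OF K]
    using n by simp
qed

section \<open>Counting 4-cycles through their edges\<close>

lemma card_subset_le3: "S \<subseteq> {p, r, s} \<Longrightarrow> card S \<le> 3"
  using card_mono[of "{p, r, s}" S] by (auto simp: card_insert_if split: if_splits)

lemma card_subset_eq4:
  assumes "S \<subseteq> {p, r, s, t}" "card S = 4"
  shows "S = {p, r, s, t}"
  by (rule card_seteq) (use assms in \<open>auto simp: card_insert_if\<close>)

context edge_graph
begin

text \<open>The pairs that complete the edge to the 4-cycle \<open>u, v, b, a\<close>. The first
  component is attached to \<open>u\<close>, so the set depends on the orientation of the
  edge.\<close>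

definition closing_pairs :: "'a \<Rightarrow> 'a \<Rightarrow> ('a \<times> 'a) set" where
  "closing_pairs u v = {(a, b). a \<in> neighbours u - {v} \<and> b \<in> neighbours v - {u} \<and> {a, b} \<in> E}"

text \<open>Of the six pairs on the four vertices, triangle-freeness leaves only a cycle: every
  other arrangement around \<open>{u, v}\<close> has at most three edges.\<close>

lemma four_cycle_through_edge:
  assumes tf: triangle_free and S: "S \<in> four_cycles" and uv: "{u, v} \<in> S"
  shows "\<exists>a b. (a, b) \<in> closing_pairs u v \<and> S = {{u, v}, {u, a}, {v, b}, {a, b}}"
proof -
  have SE: "S \<subseteq> E" "card S = 4" "card (\<Union>S) = 4" using S by (auto simp: four_cycles_def)
  have uv': "u \<noteq> v" using edge_distinct uv SE by blast
  have "card (\<Union>S - {u, v}) = 2"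
  proof -
    have "{u, v} \<subseteq> \<Union>S" using uv by blast
    then have "card (\<Union>S - {u, v}) = card (\<Union>S) - card {u, v}"
      by (intro card_Diff_subset) auto
    then show ?thesis using SE(3) uv' by simp
  qed
  then obtain x y where xy: "\<Union>S - {u, v} = {x, y}" "x \<noteq> y"
    by (auto simp: card_2_iff)
  then have ne: "x \<noteq> u" "x \<noteq> v" "y \<noteq> u" "y \<noteq> v" by auto
  have U: "\<Union>S \<subseteq> {u, v, x, y}" using xy by blast
  have sub: "e \<in> {{u, v}, {u, x}, {u, y}, {v, x}, {v, y}, {x, y}}" if eS: "e \<in> S" for e
  proof -
    obtain p r where e: "e = {p, r}" "p \<noteq> r"
      using edge_as_pair SE(1) eS by blast
    have "e \<subseteq> {u, v, x, y}" using U eS by blast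
    then have "p = u \<or> p = v \<or> p = x \<or> p = y" "r = u \<or> r = v \<or> r = x \<or> r = y"
      using e by simp_all
    then show ?thesis unfolding e(1) using e(2) by (elim disjE) (simp_all add: insert_commute)
  qed
  have tri: "\<not> ({p, r} \<in> S \<and> {r, s} \<in> S \<and> {p, s} \<in> S)" for p r s
    using triangle_freeD[OF tf, of p r s] SE by blast
  have t1: "\<not> ({u, x} \<in> S \<and> {v, x} \<in> S)" using tri[of u v x] uv by blast
  have t2: "\<not> ({u, y} \<in> S \<and> {v, y} \<in> S)" using tri[of u v y] uv by blast
  have t3: "\<not> ({u, x} \<in> S \<and> {u, y} \<in> S \<and> {x, y} \<in> S)" using tri[of u x y] by blast
  have t4: "\<not> ({v, x} \<in> S \<and> {v, y} \<in> S \<and> {x, y} \<in> S)" using tri[of v x y] by blast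
  have no3: "\<not> S \<subseteq> {p, r, s}" for p r s
    using card_subset_le3[of S p r s] SE(2) by auto
  \<comment> \<open>Without this edge, \<open>x\<close> and \<open>y\<close> are each joined to at
    most one of \<open>u\<close> and \<open>v\<close>, which leaves room for three edges
    only.\<close>
  have xyS: "{x, y} \<in> S"
  proof (rule ccontr)
    assume n: "{x, y} \<notin> S"
    have "\<exists>p r. S \<subseteq> {{u, v}, p, r}"
    proof (cases "{u, x} \<in> S")
      case True
      then have "{v, x} \<notin> S" using t1 by blast
      then show ?thesis
      proof (cases "{u, y} \<in> S")
        case True
        then have "{v, y} \<notin> S" using t2 by blast
        then have "S \<subseteq> {{u, v}, {u, x}, {u, y}}" using sub n \<open>{v, x} \<notin> S\<close> by blast
        then show ?thesis by blast
      next
        case False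
        then have "S \<subseteq> {{u, v}, {u, x}, {v, y}}" using sub n \<open>{v, x} \<notin> S\<close> by blast
        then show ?thesis by blast
      qed
    next
      case ux: False
      then show ?thesis
      proof (cases "{u, y} \<in> S")
        case True
        then have "{v, y} \<notin> S" using t2 by blast
        then have "S \<subseteq> {{u, v}, {v, x}, {u, y}}" using sub n ux by blast
        then show ?thesis by blast
      next
        case False
        then have "S \<subseteq> {{u, v}, {v, x}, {v, y}}" using sub n ux by blast
        then show ?thesis by blast
      qed
    qed
    then obtain p r where "S \<subseteq> {{u, v}, p, r}" by (elim exE)
    then show False by (rule notE[OF no3])
  qed
  \<comment> \<open>\<open>a\<close> is the one of \<open>x\<close>, \<open>y\<close> joined to
    \<open>u\<close>. If neither is, then \<open>v\<close> is joined to at most one of them because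
    of \<open>{x, y}\<close>, and again only three edges remain.\<close>
  have "\<exists>a b. a \<noteq> v \<and> b \<noteq> u \<and> S \<subseteq> {{u, v}, {u, a}, {v, b}, {a, b}}"
  proof (cases "{u, x} \<in> S")
    case True
    then have "{v, x} \<notin> S" "{u, y} \<notin> S" using t1 t3 xyS by auto
    then have "S \<subseteq> {{u, v}, {u, x}, {v, y}, {x, y}}" using sub by blast
    then show ?thesis using ne by blast
  next
    case ux: False
    show ?thesis
    proof (cases "{u, y} \<in> S")
      case True
      then have "{v, y} \<notin> S" using t2 by blast
      then have "S \<subseteq> {{u, v}, {u, y}, {v, x}, {y, x}}" using sub ux by (auto simp: insert_commute)
      then show ?thesis using ne by blast
    next
      case False
      have "\<exists>p. S \<subseteq> {{u, v}, p, {x, y}}"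
      proof (cases "{v, x} \<in> S")
        case True
        then have "{v, y} \<notin> S" using t4 xyS by blast
        then have "S \<subseteq> {{u, v}, {v, x}, {x, y}}" using sub ux False by blast
        then show ?thesis by blast
      next
        case vx: False
        then have "S \<subseteq> {{u, v}, {v, y}, {x, y}}" using sub ux False by blast
        then show ?thesis by blast
      qed
      then obtain p where "S \<subseteq> {{u, v}, p, {x, y}}" ..
      then show ?thesis by (rule notE[OF no3])
    qed
  qed
  then obtain a b where ab: "a \<noteq> v" "b \<noteq> u" "S \<subseteq> {{u, v}, {u, a}, {v, b}, {a, b}}"
    by blast
  have eq: "S = {{u, v}, {u, a}, {v, b}, {a, b}}"
    by (rule card_subset_eq4[OF ab(3) SE(2)])
  then have "{u, a} \<in> E" "{v, b} \<in> E" "{a, b} \<in> E" using SE(1) by blast+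
  then have "(a, b) \<in> closing_pairs u v"
    using ab by (auto simp: closing_pairs_def neighbours_def)
  then show ?thesis using eq by blast
qed

lemma card_four_cycles_through_edge:
  assumes tf: triangle_free and uv: "{u, v} \<in> E"
  shows "card {S \<in> four_cycles. {u, v} \<in> S} = card (closing_pairs u v)"
proof -
  let ?f = "\<lambda>(a, b). {{u, v}, {u, a}, {v, b}, {a, b}}"
  have uv': "u \<noteq> v" using edge_distinct uv by blast
  have props: "a \<noteq> u" "a \<noteq> v" "b \<noteq> u" "b \<noteq> v" "a \<noteq> b" "{u, a} \<in> E" "{v, b} \<in> E" "{a, b} \<in> E"
    if "(a, b) \<in> closing_pairs u v" for a b
    using that edge_distinct by (auto simp: closing_pairs_def neighbours_def)
  have "bij_betw ?f (closing_pairs u v) {S \<in> four_cycles. {u, v} \<in> S}"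
  proof (rule bij_betw_imageI)
    show "inj_on ?f (closing_pairs u v)"
    proof (rule inj_onI)
      fix p p' assume p: "p \<in> closing_pairs u v" "p' \<in> closing_pairs u v" and eq: "?f p = ?f p'"
      obtain a b a' b' where ab: "p = (a, b)" "p' = (a', b')" by (metis surj_pair)
      note P = props[OF p(1)[unfolded ab]] and P' = props[OF p(2)[unfolded ab]]
      have eq': "{{u, v}, {u, a}, {v, b}, {a, b}} = {{u, v}, {u, a'}, {v, b'}, {a', b'}}"
        using eq ab by simp
      \<comment> \<open>The cycle determines \<open>a\<close> as the second neighbour of
        \<open>u\<close> on it; likewise \<open>b\<close> is recovered from
        \<open>v\<close>.\<close>
      have "{u, a} \<in> {{u, v}, {u, a'}, {v, b'}, {a', b'}}"
        by (rule subsetD[OF equalityD1[OF eq']]) simp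
      then have "a = a'" using P P' uv' by (simp add: doubleton_eq_iff)
      moreover have "{v, b} \<in> {{u, v}, {u, a'}, {v, b'}, {a', b'}}"
        by (rule subsetD[OF equalityD1[OF eq']]) simp
      then have "b = b'" using P P' uv' by (simp add: doubleton_eq_iff)
      ultimately show "p = p'" using ab by simp
    qed
    show "?f ` closing_pairs u v = {S \<in> four_cycles. {u, v} \<in> S}"
    proof
      show "?f ` closing_pairs u v \<subseteq> {S \<in> four_cycles. {u, v} \<in> S}"
      proof
        fix S assume "S \<in> ?f ` closing_pairs u v"
        then obtain a b where ab: "(a, b) \<in> closing_pairs u v" and S: "S = {{u, v}, {u, a}, {v, b}, {a, b}}"
          by auto
        note P = props[OF ab]
        have "{u, v} \<noteq> {u, a}" "{u, v} \<noteq> {v, b}" "{u, v} \<noteq> {a, b}"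
          "{u, a} \<noteq> {v, b}" "{u, a} \<noteq> {a, b}" "{v, b} \<noteq> {a, b}"
          using P uv' by (simp_all add: doubleton_eq_iff)
        then have "card S = 4" unfolding S by simp
        moreover have "\<Union>S = {u, v, a, b}" unfolding S by blast
        then have "card (\<Union>S) = 4" using P uv' by (simp add: card_insert_if)
        ultimately show "S \<in> {S \<in> four_cycles. {u, v} \<in> S}"
          using P uv S by (simp add: four_cycles_def)
      qed
      show "{S \<in> four_cycles. {u, v} \<in> S} \<subseteq> ?f ` closing_pairs u v"
        using four_cycle_through_edge[OF tf] by force
    qed
  qed
  from bij_betw_same_card[OF this] show ?thesis by (rule sym)
qed

lemma finite_arc_pairs: "finite arc_pairs"
  by (rule finite_subset[of _ "V \<times> V"]) (use finite_V edge_in_V in \<open>auto simp: arc_pairs_def\<close>)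

lemma card_arcs_of_edges:
  assumes "S \<subseteq> E"
  shows "card {p \<in> arc_pairs. {fst p, snd p} \<in> S} = 2 * card S"
proof -
  have "(\<Sum>e\<in>S. card {p \<in> arc_pairs. {fst p, snd p} = e})
      = 1 * card {p \<in> arc_pairs. {fst p, snd p} \<in> S}"
  proof -
    have "(\<Sum>e\<in>S. card {p \<in> {p \<in> arc_pairs. {fst p, snd p} \<in> S}. {fst p, snd p} = e})
      = 1 * card {p \<in> arc_pairs. {fst p, snd p} \<in> S}"
    proof (rule sum_multicount)
      show "finite S" using assms finite_E finite_subset by blast
      show "finite {p \<in> arc_pairs. {fst p, snd p} \<in> S}" using finite_arc_pairs by simp
      show "\<forall>p\<in>{p \<in> arc_pairs. {fst p, snd p} \<in> S}. card {e \<in> S. {fst p, snd p} = e} = 1"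
      proof
        fix p assume "p \<in> {p \<in> arc_pairs. {fst p, snd p} \<in> S}"
        then have "{e \<in> S. {fst p, snd p} = e} = {{fst p, snd p}}" by auto
        then show "card {e \<in> S. {fst p, snd p} = e} = 1" by simp
      qed
    qed
    moreover have "{p \<in> {p \<in> arc_pairs. {fst p, snd p} \<in> S}. {fst p, snd p} = e} = {p \<in> arc_pairs. {fst p, snd p} = e}"
      if "e \<in> S" for e using that by auto
    ultimately show ?thesis by simp
  qed
  moreover have "card {p \<in> arc_pairs. {fst p, snd p} = e} = 2" if eS: "e \<in> S" for e
  proof -
    obtain a b where e: "e = {a, b}" "a \<noteq> b"
      using edge_as_pair eS assms by blast
    have "{p \<in> arc_pairs. {fst p, snd p} = e} = {(a, b), (b, a)}"
      using e eS assms by (auto simp: arc_pairs_def doubleton_eq_iff insert_commute)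
    then show ?thesis using e by simp
  qed
  ultimately show ?thesis by simp
qed

lemma card_arc_pairs: "card arc_pairs = 2 * card E"
proof -
  have "{p \<in> arc_pairs. {fst p, snd p} \<in> E} = arc_pairs"
    by (auto simp: arc_pairs_def)
  then show ?thesis using card_arcs_of_edges[OF subset_refl] by simp
qed

text \<open>The factor 8 is four edges per cycle times two orientations per edge.\<close>

lemma card_four_cycles:
  assumes triangle_free
  shows "8 * card four_cycles = (\<Sum>(u, v)\<in>arc_pairs. card (closing_pairs u v))"
proof -
  have fin: "finite four_cycles"
    unfolding four_cycles_def by (rule finite_subfamilies)
  have "(\<Sum>p\<in>arc_pairs. card {S \<in> four_cycles. {fst p, snd p} \<in> S}) = 8 * card four_cycles"
    by (rule sum_multicount[OF finite_arc_pairs fin])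
      (use card_arcs_of_edges in \<open>auto simp: four_cycles_def\<close>)
  moreover have "(\<Sum>p\<in>arc_pairs. card {S \<in> four_cycles. {fst p, snd p} \<in> S})
      = (\<Sum>p\<in>arc_pairs. card (closing_pairs (fst p) (snd p)))"
    by (rule sum.cong[OF refl])
      (use card_four_cycles_through_edge[OF assms] in \<open>auto simp: arc_pairs_def\<close>)
  ultimately show ?thesis by (simp add: split_def)
qed

lemma closing_pairs_subset: "closing_pairs u v \<subseteq> (neighbours u - {v}) \<times> (neighbours v - {u})"
  by (auto simp: closing_pairs_def)

lemma card_punctured_neighbours:
  assumes "{u, v} \<in> E"
  shows "card ((neighbours u - {v}) \<times> (neighbours v - {u})) = (d - 1)\<^sup>2"
proof -
  have "v \<in> neighbours u" "u \<in> neighbours v"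
    using assms by (auto simp: neighbours_def insert_commute)
  then show ?thesis
    using edge_in_V[OF assms]
    by (simp add: card_cartesian_product card_Diff_singleton card_neighbours power2_eq_square)
qed

lemma card_closing_pairs_le:
  assumes "{u, v} \<in> E"
  shows "card (closing_pairs u v) \<le> (d - 1)\<^sup>2"
  using card_mono[OF _ closing_pairs_subset[of u v]] card_punctured_neighbours[OF assms]
  by (simp add: finite_neighbours)

lemma card_four_cycles_closed:
  assumes triangle_free biclique_closed
  shows "8 * card four_cycles = 2 * card E * (d - 1)\<^sup>2"
proof -
  have "(\<Sum>(u, v)\<in>arc_pairs. card (closing_pairs u v)) = (\<Sum>(u, v)\<in>arc_pairs. (d - 1)\<^sup>2)"
  proof (rule sum.cong[OF refl], clarify)
    fix u v assume "(u, v) \<in> arc_pairs"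
    then have uv: "{u, v} \<in> E" by (simp add: arc_pairs_def)
    have "closing_pairs u v = (neighbours u - {v}) \<times> (neighbours v - {u})"
      using assms(2) uv unfolding closing_pairs_def neighbours_def biclique_closed_def by blast
    then show "card (closing_pairs u v) = (d - 1)\<^sup>2"
      using card_punctured_neighbours[OF uv] by simp
  qed
  then show ?thesis
    using card_four_cycles[OF assms(1)] card_arc_pairs by simp
qed

text \<open>A walk \<open>a, u, v, b\<close> that does not close up leaves the pair
  \<open>(a, b)\<close> out at the arc \<open>(u, v)\<close>, while no arc exceeds
  \<open>(d - 1)\<^sup>2\<close>.\<close>

lemma card_four_cycles_not_closed:
  assumes triangle_free "\<not> biclique_closed"
  shows "8 * card four_cycles < 2 * card E * (d - 1)\<^sup>2"
proof -
  obtain u v a b where *: "{u, v} \<in> E" "{u, a} \<in> E" "{v, b} \<in> E" "{a, b} \<notin> E"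
    using assms(2) unfolding biclique_closed_def by blast
  then have "a \<noteq> v" "b \<noteq> u" by (auto simp: insert_commute)
  then have "(a, b) \<in> (neighbours u - {v}) \<times> (neighbours v - {u}) - closing_pairs u v"
    using * by (auto simp: neighbours_def closing_pairs_def)
  then have "closing_pairs u v \<subset> (neighbours u - {v}) \<times> (neighbours v - {u})"
    using closing_pairs_subset[of u v] by blast
  then have "card (closing_pairs u v) < (d - 1)\<^sup>2"
    using psubset_card_mono card_punctured_neighbours[OF *(1)] finite_neighbours
    by (metis finite_Diff finite_cartesian_product)
  then have "(\<Sum>(u, v)\<in>arc_pairs. card (closing_pairs u v)) < (\<Sum>(u, v)\<in>arc_pairs. (d - 1)\<^sup>2)"
    by (intro sum_strict_mono_ex1 finite_arc_pairs)
      (use *(1) card_closing_pairs_le in \<open>auto simp: arc_pairs_def intro!: bexI[of _ "(u, v)"]\<close>)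
  then show ?thesis
    using card_four_cycles[OF assms(1)] card_arc_pairs by simp
qed

end

section \<open>Comparison of two regular graphs\<close>

lemma card_even_odd_subsets:
  assumes "finite E" "E \<noteq> {}"
  shows "card {S. S \<subseteq> E \<and> even (card S)} = 2 ^ (card E - 1)"
    "card {S. S \<subseteq> E \<and> odd (card S)} = 2 ^ (card E - 1)"
proof -
  let ?A = "{S. S \<subseteq> E \<and> even (card S)}" and ?B = "{S. S \<subseteq> E \<and> odd (card S)}"
  have eq: "card ?A = card ?B"
    using card_subsupersets_even_odd[of E "{}"] assms by (simp add: psubset_eq)
  have "Pow E = ?A \<union> ?B" by auto
  then have "2 ^ card E = card (?A \<union> ?B)" using card_Pow[OF assms(1)] by metis
  also have "\<dots> = card ?A + card ?B"
    by (rule card_Un_disjoint) (use assms in auto)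
  finally have "2 ^ card E = 2 * card ?A" using eq by simp
  moreover have "card E \<noteq> 0" using assms by simp
  then have "(2::nat) ^ card E = 2 * 2 ^ (card E - 1)" by (simp add: power_eq_if)
  ultimately show "card ?A = 2 ^ (card E - 1)" "card ?B = 2 ^ (card E - 1)" using eq by simp_all
qed

text \<open>
  Only the terms of one sign can push an alternating sum in a given direction, and they make up half of all subsets.
\<close>

lemma abs_alternating_sum_le:
  fixes p :: "'a set \<Rightarrow> real"
  assumes "finite E" "E \<noteq> {}" "R \<subseteq> Pow E" and p: "\<And>S. S \<in> R \<Longrightarrow> 0 \<le> p S" "\<And>S. S \<in> R \<Longrightarrow> p S \<le> B" and "0 \<le> B"
  shows "\<bar>\<Sum>S\<in>R. (-1) ^ card S * p S\<bar> \<le> 2 ^ (card E - 1) * B"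
proof -
  let ?A = "{S \<in> R. even (card S)}" and ?B = "{S \<in> R. odd (card S)}"
  have fin: "finite R" by (rule finite_subset[OF assms(3)]) (simp add: assms(1))
  \<comment> \<open>\<open>U\<close> will be the family of all even or all odd subsets of
    \<open>E\<close>. Both partial sums then lie in the same interval starting at 0, so their
    difference is at most its length.\<close>
  have part: "0 \<le> sum p T \<and> sum p T \<le> 2 ^ (card E - 1) * B"
    if "T \<subseteq> R" "T \<subseteq> U" "card U = 2 ^ (card E - 1)" "finite U" for T U
  proof
    show "0 \<le> sum p T" using that p by (intro sum_nonneg) auto
    have "sum p T \<le> real (card T) * B" using that p by (intro sum_bounded_above) auto
    also have "\<dots> \<le> real (card U) * B"
      using card_mono[OF that(4,2)] assms by (intro mult_right_mono) auto
    finally show "sum p T \<le> 2 ^ (card E - 1) * B" using that by simp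
  qed
  have "0 \<le> sum p ?A \<and> sum p ?A \<le> 2 ^ (card E - 1) * B"
    by (rule part[OF _ _ card_even_odd_subsets(1)[OF assms(1,2)]]) (use assms in auto)
  moreover have "0 \<le> sum p ?B \<and> sum p ?B \<le> 2 ^ (card E - 1) * B"
    by (rule part[OF _ _ card_even_odd_subsets(2)[OF assms(1,2)]]) (use assms in auto)
  moreover have "(\<Sum>S\<in>R. (-1) ^ card S * p S) = sum p ?A - sum p ?B"
  proof -
    have "R = ?A \<union> ?B" by auto
    then have "(\<Sum>S\<in>R. (-1) ^ card S * p S) = (\<Sum>S\<in>?A \<union> ?B. (-1) ^ card S * p S)" by simp
    also have "\<dots> = (\<Sum>S\<in>?A. (-1) ^ card S * p S) + (\<Sum>S\<in>?B. (-1) ^ card S * p S)"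
      by (rule sum.union_disjoint) (use fin in auto)
    finally show ?thesis by (simp add: sum_negf)
  qed
  ultimately show ?thesis by linarith
qed

text \<open>The homomorphism count into the complete looped graph with \<open>l\<close> loops
  deleted, stated for edge sets: the only forbidden event is that an edge receives one of the
  unlooped colours at both ends.\<close>

definition proper_count :: "'a set \<Rightarrow> 'a set set \<Rightarrow> nat \<Rightarrow> nat \<Rightarrow> nat" where
  "proper_count V E q l = card {f \<in> V \<rightarrow>\<^sub>E {..<q}. \<forall>e\<in>E. \<not> constant_below l f e}"

context edge_graph
begin

text \<open>\<open>k\<close> marks where the two graphs may begin to differ: it is 2 in the presence
  of triangles and 3 without them.\<close>

lemma proper_count_expansion:
  assumes "q > 0"
  shows "real (proper_count V E q l) / real q ^ card V
    = (\<Sum>j\<le>k. (-1) ^ j * (\<Sum>S | S \<subseteq> E \<and> card S = j. mono_prob V q l S))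
      + (\<Sum>S | S \<subseteq> E \<and> k < card S. (-1) ^ card S * mono_prob V q l S)"
proof -
  let ?g = "\<lambda>S. (-1) ^ card S * mono_prob V q l S"
  let ?L = "{S. S \<subseteq> E \<and> card S \<le> k}" and ?H = "{S. S \<subseteq> E \<and> k < card S}"
  have "real (proper_count V E q l) / real q ^ card V = (\<Sum>S\<in>Pow E. ?g S)"
    unfolding proper_count_def card_maps_inclusion_exclusion[OF finite_V finite_E]
    by (simp add: sum_divide_distrib mono_prob_def)
  also have "Pow E = ?L \<union> ?H" by auto
  also have "(\<Sum>S\<in>?L \<union> ?H. ?g S) = (\<Sum>S\<in>?L. ?g S) + (\<Sum>S\<in>?H. ?g S)"
    by (rule sum.union_disjoint) (auto simp: finite_subfamilies)
  also have "(\<Sum>S\<in>?L. ?g S) = (\<Sum>j\<le>k. \<Sum>S\<in>{S \<in> ?L. card S = j}. ?g S)"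
    by (rule sum.group[symmetric]) (auto simp: finite_subfamilies)
  also have "\<dots> = (\<Sum>j\<le>k. (-1) ^ j * (\<Sum>S | S \<subseteq> E \<and> card S = j. mono_prob V q l S))"
  proof (rule sum.cong[OF refl])
    fix j assume "j \<in> {..k}"
    then have "{S \<in> ?L. card S = j} = {S. S \<subseteq> E \<and> card S = j}" by auto
    then have "(\<Sum>S\<in>{S \<in> ?L. card S = j}. ?g S) = (\<Sum>S | S \<subseteq> E \<and> card S = j. (-1) ^ j * mono_prob V q l S)"
      by (auto intro!: sum.cong)
    then show "(\<Sum>S\<in>{S \<in> ?L. card S = j}. ?g S) = (-1) ^ j * (\<Sum>S | S \<subseteq> E \<and> card S = j. mono_prob V q l S)"
      by (simp add: sum_distrib_left)
  qed
  finally show ?thesis .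
qed

text \<open>All these sets are forests, so \<open>card (\<Union>S) - j\<close> is their number of
  components. A forest with \<open>j \<ge> 1\<close> edges covers at least \<open>j + 1\<close>
  vertices and at most \<open>2 * j\<close>, which for \<open>j \<le> 3\<close> fits into three
  consecutive values; the empty set needs its own starting value 0.\<close>

lemma mono_prob_low:
  assumes q: "l \<le> q" "q > 0" and S: "S \<subseteq> E" "card S = j" and j: "j \<le> 2 \<or> j = 3 \<and> triangle_free"
  shows "card (\<Union>S) \<in> {if j = 0 then 0 else j + 1, (if j = 0 then 0 else j + 1) + 1, (if j = 0 then 0 else j + 1) + 2}
    \<and> mono_prob V q l S = real l ^ (card (\<Union>S) - j) / real q ^ card (\<Union>S)"
proof -
  have finS: "finite S" using S finite_E finite_subset by blast
  consider "j = 0" | "j = 1" | "j = 2" | "j = 3" triangle_free using j by linarith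
  then show ?thesis
  proof cases
    case 1
    then have "S = {}" using S finS by simp
    then show ?thesis using 1 mono_prob_empty[OF finite_V q(2)] by simp
  next
    case 2
    then obtain e where e: "S = {e}" "e \<in> E" using S by (auto simp: card_1_singleton_iff)
    then show ?thesis using 2 mono_prob_edge[OF q, of e] edge_card[OF e(2)] by simp
  next
    case 3
    then show ?thesis using mono_prob_two_edges[OF q S(1)] S(2) by auto
  next
    case 4
    then have S3: "card S = 3" using S by simp
    have "card (\<Union>S) \<noteq> 3" using 4(2) S(1) S3 unfolding triangle_free_def by blast
    then have c: "card (\<Union>S) \<in> {4, 5, 6}" using mono_prob_three_edges(1)[OF q S(1) S3] by simp
    then have "max 1 (card (\<Union>S) - 3) = card (\<Union>S) - 3" by auto
    then show ?thesis using mono_prob_three_edges(2)[OF q S(1) S3] c 4(1) by auto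
  qed
qed

text \<open>\<open>X\<close> holds the dominant sets of the tail, namely triangles or 4-cycles, or
  is empty; everything else obeys the smaller bound \<open>B\<close>.\<close>

lemma tail_estimate:
  assumes "E \<noteq> {}" "X \<subseteq> {S. S \<subseteq> E \<and> k < card S}" "0 \<le> B"
    and B: "\<And>S. S \<subseteq> E \<Longrightarrow> k < card S \<Longrightarrow> S \<notin> X \<Longrightarrow> mono_prob V q l S \<le> B"
  shows "\<bar>(\<Sum>S | S \<subseteq> E \<and> k < card S. (-1) ^ card S * mono_prob V q l S)
      - (\<Sum>S\<in>X. (-1) ^ card S * mono_prob V q l S)\<bar> \<le> 2 ^ (card E - 1) * B"
proof -
  let ?H = "{S. S \<subseteq> E \<and> k < card S}" and ?g = "\<lambda>S. (-1) ^ card S * mono_prob V q l S"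
  have "(\<Sum>S\<in>?H. ?g S) = (\<Sum>S\<in>?H - X. ?g S) + (\<Sum>S\<in>X. ?g S)"
    by (rule sum.subset_diff) (use assms finite_subfamilies in auto)
  moreover have "\<bar>\<Sum>S\<in>?H - X. ?g S\<bar> \<le> 2 ^ (card E - 1) * B"
    by (rule abs_alternating_sum_le[OF finite_E assms(1)])
      (use assms mono_prob_nonneg[of V q l] in auto)
  ultimately show ?thesis by simp
qed

end

lemma sum_mono_prob_eq:
  assumes G: "edge_graph V E d" and K: "edge_graph V' E' d" and n: "card V = card V'"
    and q: "l \<le> q" "q > 0"
    and j: "j \<le> 2 \<or> j = 3 \<and> edge_graph.triangle_free E \<and> edge_graph.triangle_free E'"
  shows "(\<Sum>S | S \<subseteq> E \<and> card S = j. mono_prob V q l S) = (\<Sum>S | S \<subseteq> E' \<and> card S = j. mono_prob V' q l S)"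
proof -
  let ?h = "\<lambda>m. real l ^ (m - j) / real q ^ m"
  have jG: "j \<le> 2 \<or> j = 3 \<and> edge_graph.triangle_free E"
    and jK: "j \<le> 2 \<or> j = 3 \<and> edge_graph.triangle_free E'" using j by auto
  note lowG = edge_graph.mono_prob_low[OF G q _ _ jG] and lowK = edge_graph.mono_prob_low[OF K q _ _ jK]
  have "(\<Sum>S | S \<subseteq> E \<and> card S = j. mono_prob V q l S) = (\<Sum>S | S \<subseteq> E \<and> card S = j. ?h (card (\<Union>S)))"
    by (rule sum.cong[OF refl]) (use lowG in simp)
  also have "\<dots> = (\<Sum>S | S \<subseteq> E' \<and> card S = j. ?h (card (\<Union>S)))"
    by (rule sum_cover_eq[OF G K n lowG[THEN conjunct1] lowK[THEN conjunct1]])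
  also have "\<dots> = (\<Sum>S | S \<subseteq> E' \<and> card S = j. mono_prob V' q l S)"
    by (rule sum.cong[OF refl]) (use lowK in simp)
  finally show ?thesis .
qed

lemma proper_count_lessI:
  assumes "card V = card V'" "q > 0"
    and "real (proper_count V E q l) / real q ^ card V < real (proper_count V' E' q l) / real q ^ card V'"
  shows "proper_count V E q l < proper_count V' E' q l"
  using assms by (simp add: divide_less_cancel)

text \<open>Sets of at most two edges cancel. Each triangle then contributes
  \<open>- l / q ^ 3\<close> to the first graph only, and all other terms are of order
  \<open>l / q ^ 4\<close>.\<close>

lemma proper_count_less_of_triangle:
  assumes G: "edge_graph V E d" and K: "edge_graph V' E' d" and n: "card V = card V'"
    and q: "1 \<le> l" "l \<le> q" "2 ^ card E < q"
    and tri: "\<not> edge_graph.triangle_free E" and K_tf: "edge_graph.triangle_free E'"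
  shows "proper_count V E q l < proper_count V' E' q l"
proof -
  interpret G: edge_graph V E d by fact
  interpret K: edge_graph V' E' d by fact
  have q0: "q > 0" using q by auto
  have cE: "card E = card E'" using G.handshake K.handshake n by simp
  let ?B = "real l / real q ^ 4"
  let ?X = "{S. S \<subseteq> E \<and> card S = 3 \<and> card (\<Union>S) = 3}"
  let ?tG = "\<Sum>S | S \<subseteq> E \<and> 2 < card S. (-1) ^ card S * mono_prob V q l S"
  let ?tK = "\<Sum>S | S \<subseteq> E' \<and> 2 < card S. (-1) ^ card S * mono_prob V' q l S"
  have X: "?X \<noteq> {}" using tri by (auto simp: G.triangle_free_def)
  have "card E \<noteq> 0"
  proof
    assume "card E = 0"
    then have "E = {}" using G.finite_E by simp
    then show False using X by auto
  qed
  then have ne: "E \<noteq> {}" "E' \<noteq> {}" using cE by auto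
  have "\<bar>?tG - (\<Sum>S\<in>?X. (-1) ^ card S * mono_prob V q l S)\<bar> \<le> 2 ^ (card E - 1) * ?B"
    by (rule G.tail_estimate[OF ne(1)]) (use G.mono_prob_ge_three[OF q(2) q0] in auto)
  moreover have "(\<Sum>S\<in>?X. (-1) ^ card S * mono_prob V q l S) = - (real (card ?X) * (real l / real q ^ 3))"
  proof -
    have "(\<Sum>S\<in>?X. (-1) ^ card S * mono_prob V q l S) = (\<Sum>S\<in>?X. - (real l / real q ^ 3))"
      by (rule sum.cong[OF refl]) (use G.mono_prob_three_edges(2)[OF q(2) q0] in auto)
    then show ?thesis by simp
  qed
  moreover have "real l / real q ^ 3 \<le> real (card ?X) * (real l / real q ^ 3)"
  proof -
    have "card ?X \<ge> 1" using X G.finite_subfamilies by (simp add: Suc_leI card_gt_0_iff)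
    then have "1 * (real l / real q ^ 3) \<le> real (card ?X) * (real l / real q ^ 3)"
      by (intro mult_right_mono) auto
    then show ?thesis by simp
  qed
  \<comment> \<open>The second graph has no triangles, so no exceptional sets are separated from its
    tail.\<close>
  moreover have "\<bar>?tK - (\<Sum>S\<in>{}. (-1) ^ card S * mono_prob V' q l S)\<bar> \<le> 2 ^ (card E' - 1) * ?B"
    by (rule K.tail_estimate[OF ne(2)])
      (use K.mono_prob_ge_three[OF q(2) q0] K_tf in \<open>auto simp: K.triangle_free_def\<close>)
  \<comment> \<open>The two error terms of the two graphs add up to \<open>2 ^ card E\<close> times
    the bound; here the hypothesis on \<open>q\<close> enters, trading that factor for one power of
    \<open>q\<close>.\<close>
  moreover have "2 * (2 ^ (card E - 1) * ?B) < real l / real q ^ 3"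
  proof -
    have "2 * (2 ^ (card E - 1) * ?B) = 2 ^ card E * ?B"
      using \<open>card E \<noteq> 0\<close> by (simp add: power_eq_if)
    also have "\<dots> < real q * ?B"
    proof (rule mult_strict_right_mono)
      have "real (2 ^ card E) < real q" using q(3) by (rule of_nat_less_iff[THEN iffD2])
      then show "2 ^ card E < real q" by simp
    qed (use q q0 in auto)
    also have "\<dots> = real l / real q ^ 3" using q0 by (simp add: eval_nat_numeral)
    finally show ?thesis .
  qed
  ultimately have "?tG < ?tK" using cE by simp
  moreover have "(\<Sum>j\<le>2. (-1) ^ j * (\<Sum>S | S \<subseteq> E \<and> card S = j. mono_prob V q l S))
     = (\<Sum>j\<le>2. (-1) ^ j * (\<Sum>S | S \<subseteq> E' \<and> card S = j. mono_prob V' q l S))"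
    by (rule sum.cong[OF refl]) (use sum_mono_prob_eq[OF G K n q(2) q0] in auto)
  ultimately have "real (proper_count V E q l) / real q ^ card V < real (proper_count V' E' q l) / real q ^ card V'"
    unfolding G.proper_count_expansion[OF q0, of l 2] K.proper_count_expansion[OF q0, of l 2] by linarith
  then show ?thesis by (rule proper_count_lessI[OF n q0])
qed

text \<open>Now the triples cancel too. A 4-cycle has even size and counts positively with
  \<open>l / q ^ 4\<close>, so a single additional one outweighs both errors of order
  \<open>l / q ^ 5\<close>.\<close>

lemma proper_count_less_of_four_cycles:
  assumes G: "edge_graph V E d" and K: "edge_graph V' E' d" and n: "card V = card V'"
    and q: "1 \<le> l" "l \<le> q" "2 ^ card E < q"
    and G_tf: "edge_graph.triangle_free E" and K_tf: "edge_graph.triangle_free E'"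
    and less: "card (edge_graph.four_cycles E) < card (edge_graph.four_cycles E')"
  shows "proper_count V E q l < proper_count V' E' q l"
proof -
  interpret G: edge_graph V E d by fact
  interpret K: edge_graph V' E' d by fact
  have q0: "q > 0" using q by auto
  have cE: "card E = card E'" using G.handshake K.handshake n by simp
  let ?B = "real l / real q ^ 5"
  let ?c = "real l / real q ^ 4"
  let ?tG = "\<Sum>S | S \<subseteq> E \<and> 3 < card S. (-1) ^ card S * mono_prob V q l S"
  let ?tK = "\<Sum>S | S \<subseteq> E' \<and> 3 < card S. (-1) ^ card S * mono_prob V' q l S"
  have "card E \<noteq> 0"
  proof
    assume "card E = 0"
    then have "E' = {}" using K.finite_E cE by simp
    obtain S where "S \<in> K.four_cycles" using less by fastforce
    then have "S \<subseteq> E'" "card S = 4" by (simp_all add: K.four_cycles_def)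
    then show False using \<open>E' = {}\<close> by simp
  qed
  then have ne: "E \<noteq> {}" "E' \<noteq> {}" using cE by auto
  have "\<bar>?tG - (\<Sum>S\<in>G.four_cycles. (-1) ^ card S * mono_prob V q l S)\<bar> \<le> 2 ^ (card E - 1) * ?B"
    by (rule G.tail_estimate[OF ne(1)])
      (use G.mono_prob_ge_four[OF q(2) q0 G_tf] in \<open>auto simp: G.four_cycles_def\<close>)
  moreover have "(\<Sum>S\<in>G.four_cycles. (-1) ^ card S * mono_prob V q l S) = real (card G.four_cycles) * ?c"
  proof -
    have "(\<Sum>S\<in>G.four_cycles. (-1) ^ card S * mono_prob V q l S) = (\<Sum>S\<in>G.four_cycles. ?c)"
      by (rule sum.cong[OF refl])
        (use G.mono_prob_four_cycle[OF q(2) q0 G_tf] in \<open>auto simp: G.four_cycles_def\<close>)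
    then show ?thesis by simp
  qed
  moreover have "\<bar>?tK - (\<Sum>S\<in>K.four_cycles. (-1) ^ card S * mono_prob V' q l S)\<bar> \<le> 2 ^ (card E' - 1) * ?B"
    by (rule K.tail_estimate[OF ne(2)])
      (use K.mono_prob_ge_four[OF q(2) q0 K_tf] in \<open>auto simp: K.four_cycles_def\<close>)
  moreover have "(\<Sum>S\<in>K.four_cycles. (-1) ^ card S * mono_prob V' q l S) = real (card K.four_cycles) * ?c"
  proof -
    have "(\<Sum>S\<in>K.four_cycles. (-1) ^ card S * mono_prob V' q l S) = (\<Sum>S\<in>K.four_cycles. ?c)"
      by (rule sum.cong[OF refl])
        (use K.mono_prob_four_cycle[OF q(2) q0 K_tf] in \<open>auto simp: K.four_cycles_def\<close>)
    then show ?thesis by simp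
  qed
  moreover have "real (card G.four_cycles) * ?c + ?c \<le> real (card K.four_cycles) * ?c"
  proof -
    have "(real (card G.four_cycles) + 1) * ?c \<le> real (card K.four_cycles) * ?c"
      using less by (intro mult_right_mono) auto
    then show ?thesis by (simp only: distrib_right mult_1)
  qed
  moreover have "2 * (2 ^ (card E - 1) * ?B) < ?c"
  proof -
    have "2 * (2 ^ (card E - 1) * ?B) = 2 ^ card E * ?B"
      using \<open>card E \<noteq> 0\<close> by (simp add: power_eq_if)
    also have "\<dots> < real q * ?B"
    proof (rule mult_strict_right_mono)
      have "real (2 ^ card E) < real q" using q(3) by (rule of_nat_less_iff[THEN iffD2])
      then show "2 ^ card E < real q" by simp
    qed (use q q0 in auto)
    also have "\<dots> = ?c" using q0 by (simp add: eval_nat_numeral)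
    finally show ?thesis .
  qed
  ultimately have "?tG < ?tK" using cE by simp
  moreover have "(\<Sum>j\<le>3. (-1) ^ j * (\<Sum>S | S \<subseteq> E \<and> card S = j. mono_prob V q l S))
     = (\<Sum>j\<le>3. (-1) ^ j * (\<Sum>S | S \<subseteq> E' \<and> card S = j. mono_prob V' q l S))"
  proof (rule sum.cong[OF refl])
    fix j :: nat assume "j \<in> {..3}"
    then have "j \<le> 2 \<or> j = 3 \<and> edge_graph.triangle_free E \<and> edge_graph.triangle_free E'"
      using G_tf K_tf by auto
    then show "(-1) ^ j * (\<Sum>S | S \<subseteq> E \<and> card S = j. mono_prob V q l S)
       = (-1) ^ j * (\<Sum>S | S \<subseteq> E' \<and> card S = j. mono_prob V' q l S)"
      using sum_mono_prob_eq[OF G K n q(2) q0] by simp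
  qed
  ultimately have "real (proper_count V E q l) / real q ^ card V < real (proper_count V' E' q l) / real q ^ card V'"
    unfolding G.proper_count_expansion[OF q0, of l 3] K.proper_count_expansion[OF q0, of l 3] by linarith
  then show ?thesis by (rule proper_count_lessI[OF n q0])
qed

theorem proper_count_less:
  assumes G: "edge_graph V E d" and K: "edge_graph V' E' d" and n: "card V = card V'"
    and q: "1 \<le> l" "l \<le> q" "2 ^ card E < q"
    and K_tf: "edge_graph.triangle_free E'" and K_closed: "edge_graph.biclique_closed E'"
    and not_extremal: "\<not> (edge_graph.triangle_free E \<and> edge_graph.biclique_closed E)"
  shows "proper_count V E q l < proper_count V' E' q l"
proof (cases "edge_graph.triangle_free E")
  case False
  then show ?thesis by (rule proper_count_less_of_triangle[OF G K n q _ K_tf])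
next
  case True
  interpret G: edge_graph V E d by fact
  interpret K: edge_graph V' E' d by fact
  have "card E = card E'" using G.handshake K.handshake n by simp
  then have "8 * card G.four_cycles < 8 * card K.four_cycles"
    using G.card_four_cycles_not_closed[OF True] not_extremal True K.card_four_cycles_closed[OF K_tf K_closed]
    by simp
  then show ?thesis
    by (intro proper_count_less_of_four_cycles[OF G K n q True K_tf]) simp
qed

section \<open>Extremal graphs\<close>

definition bipartite_blocks :: "nat \<Rightarrow> nat \<Rightarrow> (nat \<times> (nat + nat)) set" where
  "bipartite_blocks k d = {..<k} \<times> ({..<d} <+> {..<d})"

text \<open>Adjacency in the union of the copies, without membership conditions; it is meaningful
  for vertices in \<open>bipartite_blocks\<close>.\<close>

definition block_adjacent :: "nat \<times> (nat + nat) \<Rightarrow> nat \<times> (nat + nat) \<Rightarrow> bool" where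
  "block_adjacent p r \<longleftrightarrow> fst p = fst r \<and> isl (snd p) \<noteq> isl (snd r)"

context edge_graph
begin

text \<open>Closure gives an inclusion between the neighbourhoods of two vertices with a common
  neighbour, and equal degrees turn it into an equality.\<close>

lemma biclique_block:
  assumes tf: triangle_free and cl: biclique_closed and uv: "{u, v} \<in> E"
  shows "neighbours u \<inter> neighbours v = {}"
    and "\<And>a. a \<in> neighbours v \<Longrightarrow> neighbours a = neighbours u"
    and "\<And>b. b \<in> neighbours u \<Longrightarrow> neighbours b = neighbours v"
proof -
  show "neighbours u \<inter> neighbours v = {}"
    using triangle_freeD[OF tf uv] by (auto simp: neighbours_def)
  have sub: "neighbours x \<subseteq> neighbours a" if "{x, y} \<in> E" "a \<in> neighbours y" for x y a
  proof
    fix b assume "b \<in> neighbours x"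
    then have "{b, a} \<in> E" using that cl unfolding biclique_closed_def neighbours_def by blast
    then show "b \<in> neighbours a" by (simp add: neighbours_def insert_commute)
  qed
  have eq: "neighbours a = neighbours x" if "{x, y} \<in> E" "a \<in> neighbours y" for x y a
  proof -
    have "x \<in> V" "a \<in> V" using that edge_in_V neighbours_subset by auto
    then have "card (neighbours x) = card (neighbours a)" by (simp add: card_neighbours)
    then show ?thesis using card_subset_eq[OF finite_neighbours sub[OF that]] by simp
  qed
  have vu: "{v, u} \<in> E" using uv by (simp add: insert_commute)
  show "neighbours a = neighbours u" if "a \<in> neighbours v" for a by (rule eq[OF uv that])
  show "neighbours b = neighbours v" if "b \<in> neighbours u" for b by (rule eq[OF vu that])
qed

lemma neighbours_sym: "v \<in> neighbours u \<longleftrightarrow> u \<in> neighbours v"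
  by (simp add: neighbours_def insert_commute)

end

text \<open>Induction on the number of blocks: the two neighbourhoods at the ends of an edge span a
  copy of K_{d,d} without edges to the outside, and the remaining graph satisfies the same
  hypotheses.\<close>

lemma biclique_decomposition:
  assumes "edge_graph V E d" "edge_graph.triangle_free E" "edge_graph.biclique_closed E"
    and "card V = k * (2 * d)" "d \<ge> 1"
  shows "\<exists>h. bij_betw h V (bipartite_blocks k d)
    \<and> (\<forall>x\<in>V. \<forall>y\<in>V. {x, y} \<in> E \<longleftrightarrow> block_adjacent (h x) (h y))"
  using assms
proof (induction k arbitrary: V E)
  case 0
  then have "V = {}" by (simp add: edge_graph.finite_V)
  then show ?case by (simp add: bipartite_blocks_def bij_betw_def)
next
  case (Suc k)
  interpret edge_graph V E d by fact
  note tf = Suc.prems(2) and cl = Suc.prems(3)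
  have "card V \<noteq> 0" using Suc.prems by simp
  then obtain u where u: "u \<in> V" by (metis card.empty ex_in_conv)
  have "card (neighbours u) \<noteq> 0" using card_neighbours[OF u] Suc.prems by simp
  then obtain v where "v \<in> neighbours u" by (metis card.empty ex_in_conv)
  then have uv: "{u, v} \<in> E" by (simp add: neighbours_def)
  then have v: "v \<in> V" using edge_in_V by blast
  \<comment> \<open>\<open>A\<close> is the side containing \<open>u\<close> and \<open>B\<close>
    the side containing \<open>v\<close>.\<close>
  define A where "A = neighbours v"
  define B where "B = neighbours u"
  note block = biclique_block[OF tf cl uv, folded A_def B_def]
  have AV: "A \<subseteq> V" "B \<subseteq> V" using neighbours_subset by (auto simp: A_def B_def)
  have cA: "card A = d" "card B = d" using card_neighbours u v by (auto simp: A_def B_def)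
  have finA: "finite A" "finite B" using finite_neighbours by (auto simp: A_def B_def)
  define W where "W = V - (A \<union> B)"
  define F where "F = {e \<in> E. e \<subseteq> W}"
  \<comment> \<open>No edge leaves \<open>W\<close>: a neighbour in \<open>A\<close> or
    \<open>B\<close> would place \<open>w\<close> in the opposite side. Hence vertices of
    \<open>W\<close> keep their full degree in \<open>F\<close>.\<close>
  have F: "e \<in> F" if e: "e \<in> E" "w \<in> e" "w \<in> W" for e w
  proof -
    obtain x where x: "e = {w, x}" using edge_as_pair[OF e(1)] e(2) by blast
    then have xw: "x \<in> neighbours w" using e by (simp add: neighbours_def)
    have "x \<notin> A"
    proof
      assume "x \<in> A"
      then have "w \<in> B" using block(2) xw neighbours_sym by blast
      then show False using e W_def by blast
    qed
    moreover have "x \<notin> B"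
    proof
      assume "x \<in> B"
      then have "w \<in> A" using block(3) xw neighbours_sym by blast
      then show False using e W_def by blast
    qed
    ultimately have "x \<in> W" using xw neighbours_subset by (auto simp: W_def)
    then show ?thesis using e x by (simp add: F_def)
  qed
  have "edge_graph W F d"
  proof
    show "finite W" using finite_V by (simp add: W_def)
    show "card {e \<in> F. w \<in> e} = d" if "w \<in> W" for w
    proof -
      have "{e \<in> F. w \<in> e} = {e \<in> E. w \<in> e}" using F that by (auto simp: F_def)
      then show ?thesis using degree that by (simp add: W_def)
    qed
  qed (auto simp: F_def edge_card)
  then interpret W: edge_graph W F d .
  have "F \<subseteq> E" by (auto simp: F_def)
  then have W_tf: "W.triangle_free" using tf unfolding triangle_free_def W.triangle_free_def by blast
  have W_cl: "W.biclique_closed"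
    unfolding W.biclique_closed_def
  proof (intro allI impI)
    fix x y a b assume *: "{x, y} \<in> F" "{x, a} \<in> F" "{y, b} \<in> F"
    then have "{a, b} \<in> E" using cl \<open>F \<subseteq> E\<close> unfolding biclique_closed_def by blast
    then show "{a, b} \<in> F" using * by (simp add: F_def)
  qed
  have "card (A \<union> B) = 2 * d"
    using card_Un_disjoint[OF finA] block(1) cA by (simp add: Int_commute)
  moreover have "card W = card V - card (A \<union> B)"
    unfolding W_def by (rule card_Diff_subset) (use finA AV in auto)
  ultimately have "card W = k * (2 * d)" using Suc.prems(4) by simp
  then obtain h where h: "bij_betw h W (bipartite_blocks k d)"
    and adj: "\<And>x y. x \<in> W \<Longrightarrow> y \<in> W \<Longrightarrow> {x, y} \<in> F \<longleftrightarrow> block_adjacent (h x) (h y)"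
    using Suc.IH[OF W.edge_graph_axioms W_tf W_cl _ Suc.prems(5)] by blast
  obtain \<alpha> where \<alpha>: "bij_betw \<alpha> A {..<d}"
    using ex_bij_betw_finite_nat[OF finA(1)] cA by (auto simp: atLeast0LessThan)
  obtain \<beta> where \<beta>: "bij_betw \<beta> B {..<d}"
    using ex_bij_betw_finite_nat[OF finA(2)] cA by (auto simp: atLeast0LessThan)
  \<comment> \<open>The new block receives the label \<open>k\<close>, which is free since the
    inductive map uses only labels below \<open>k\<close>.\<close>
  define g where "g x = (if x \<in> A then (k, Inl (\<alpha> x)) else if x \<in> B then (k, Inr (\<beta> x)) else h x)" for x
  have gA: "g x = (k, Inl (\<alpha> x))" if "x \<in> A" for x using that by (simp add: g_def)
  have gB: "g x = (k, Inr (\<beta> x))" if "x \<in> B" for x using that block(1) by (auto simp: g_def)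
  have gW: "g x = h x" if "x \<in> W" for x using that by (simp add: g_def W_def)
  have "bij_betw g A ({k} \<times> Inl ` {..<d})"
  proof (rule bij_betw_imageI)
    show "inj_on g A" using \<alpha> by (auto simp: inj_on_def gA bij_betw_def)
    have "g ` A = (\<lambda>i. (k, Inl i)) ` \<alpha> ` A" using gA by (force simp: image_image)
    then show "g ` A = {k} \<times> Inl ` {..<d}" using \<alpha> by (auto simp: bij_betw_def)
  qed
  moreover have "bij_betw g B ({k} \<times> Inr ` {..<d})"
  proof (rule bij_betw_imageI)
    show "inj_on g B" using \<beta> by (auto simp: inj_on_def gB bij_betw_def)
    have "g ` B = (\<lambda>i. (k, Inr i)) ` \<beta> ` B" using gB by (force simp: image_image)
    then show "g ` B = {k} \<times> Inr ` {..<d}" using \<beta> by (auto simp: bij_betw_def)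
  qed
  ultimately have "bij_betw g (A \<union> B) ({k} \<times> Inl ` {..<d} \<union> {k} \<times> Inr ` {..<d})"
    by (rule bij_betw_combine) auto
  moreover have "bij_betw g W (bipartite_blocks k d)"
    using h gW by (simp cong: bij_betw_cong)
  ultimately have "bij_betw g ((A \<union> B) \<union> W) (({k} \<times> Inl ` {..<d} \<union> {k} \<times> Inr ` {..<d}) \<union> bipartite_blocks k d)"
    by (rule bij_betw_combine) (auto simp: bipartite_blocks_def)
  moreover have "(A \<union> B) \<union> W = V" using AV by (auto simp: W_def)
  moreover have "({k} \<times> Inl ` {..<d} \<union> {k} \<times> Inr ` {..<d}) \<union> bipartite_blocks k d = bipartite_blocks (Suc k) d"
    by (auto simp: bipartite_blocks_def Plus_def lessThan_Suc)
  ultimately have bij: "bij_betw g V (bipartite_blocks (Suc k) d)" by simp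
  have hW: "fst (h x) < k" if "x \<in> W" for x
    using bij_betwE[OF h] that by (fastforce simp: bipartite_blocks_def)
  have Aadj: "{x, y} \<in> E \<longleftrightarrow> y \<in> B" if "x \<in> A" for x y
    using block(2)[OF that] by (auto simp: neighbours_def)
  have Badj: "{x, y} \<in> E \<longleftrightarrow> y \<in> A" if "x \<in> B" for x y
    using block(3)[OF that] by (auto simp: neighbours_def)
  have "{x, y} \<in> E \<longleftrightarrow> block_adjacent (g x) (g y)" if x: "x \<in> V" and y: "y \<in> V" for x y
  proof -
    have AB: "A \<inter> B = {}" using block(1) by blast
    consider "x \<in> A" | "x \<in> B" | "x \<in> W" using x by (auto simp: W_def)
    then show ?thesis
    proof cases
      case 1
      consider "y \<in> A" | "y \<in> B" | "y \<in> W" using y by (auto simp: W_def)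
      then show ?thesis
      proof cases
        case 1
        then have "y \<notin> B" using AB by blast
        then show ?thesis using Aadj[OF \<open>x \<in> A\<close>] gA[OF \<open>x \<in> A\<close>] gA[OF 1] by (simp add: block_adjacent_def)
      next
        case 2
        then show ?thesis using Aadj[OF \<open>x \<in> A\<close>] gA[OF \<open>x \<in> A\<close>] gB[OF 2] by (simp add: block_adjacent_def)
      next
        case 3
        then have "y \<notin> B" by (simp add: W_def)
        then show ?thesis using Aadj[OF \<open>x \<in> A\<close>] gA[OF \<open>x \<in> A\<close>] gW[OF 3] hW[OF 3] by (simp add: block_adjacent_def)
      qed
    next
      case 2
      consider "y \<in> A" | "y \<in> B" | "y \<in> W" using y by (auto simp: W_def)
      then show ?thesis
      proof cases
        case 1
        then show ?thesis using Badj[OF \<open>x \<in> B\<close>] gB[OF \<open>x \<in> B\<close>] gA[OF 1] by (simp add: block_adjacent_def)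
      next
        case 2
        then have "y \<notin> A" using AB by blast
        then show ?thesis using Badj[OF \<open>x \<in> B\<close>] gB[OF \<open>x \<in> B\<close>] gB[OF 2] by (simp add: block_adjacent_def)
      next
        case 3
        then have "y \<notin> A" by (simp add: W_def)
        then show ?thesis using Badj[OF \<open>x \<in> B\<close>] gB[OF \<open>x \<in> B\<close>] gW[OF 3] hW[OF 3] by (simp add: block_adjacent_def)
      qed
    next
      case 3
      show ?thesis
      proof (cases "y \<in> W")
        case True
        have "{x, y} \<in> E \<longleftrightarrow> {x, y} \<in> F" using 3 True by (simp add: F_def)
        then show ?thesis using adj[OF 3 True] gW[OF 3] gW[OF True] by simp
      next
        case False
        then have "{x, y} \<notin> E" using F[of "{x, y}" x] 3 by (auto simp: F_def)
        moreover have "fst (g y) = k" using False y gA gB by (auto simp: W_def)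
        ultimately show ?thesis using gW[OF 3] hW[OF 3] by (simp add: block_adjacent_def)
      qed
    qed
  qed
  then show ?case using bij by blast
qed

section \<open>From symmetric arc sets to edge sets, and invariance of homomorphism counts\<close>

definition edge_set :: "'a pair_pre_digraph \<Rightarrow> 'a set set" where
  "edge_set G = (\<lambda>(u, v). {u, v}) ` parcs G"

lemma edge_set_iff:
  assumes "pair_graph G"
  shows "{u, v} \<in> edge_set G \<longleftrightarrow> (u, v) \<in> parcs G"
proof -
  interpret pair_graph G by fact
  have "sym (parcs G)" using pair_sym_arcs by (simp add: symmetric_def)
  then show ?thesis by (auto simp: edge_set_def doubleton_eq_iff dest: symD)
qed

lemma edge_graph_edge_set:
  assumes "pair_graph G" "regular G d"
  shows "edge_graph (pverts G) (edge_set G) d"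
proof -
  interpret pair_graph G by fact
  show ?thesis
  proof
    show "finite (pverts G)" by (rule pair_finite_verts)
    show "e \<subseteq> pverts G" if "e \<in> edge_set G" for e
      using that by (auto simp: edge_set_def dest: in_arcsD1 in_arcsD2)
    show "card e = 2" if "e \<in> edge_set G" for e
      using that pair_no_loops by (auto simp: edge_set_def)
    show "card {e \<in> edge_set G. v \<in> e} = d" if v: "v \<in> pverts G" for v
    proof -
      have "bij_betw (\<lambda>(x, y). {x, y}) {a \<in> parcs G. fst a = v} {e \<in> edge_set G. v \<in> e}"
      proof (rule bij_betw_imageI)
        show "inj_on (\<lambda>(x, y). {x, y}) {a \<in> parcs G. fst a = v}"
          by (auto simp: inj_on_def doubleton_eq_iff)
        show "(\<lambda>(x, y). {x, y}) ` {a \<in> parcs G. fst a = v} = {e \<in> edge_set G. v \<in> e}"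
        proof
          show "{e \<in> edge_set G. v \<in> e} \<subseteq> (\<lambda>(x, y). {x, y}) ` {a \<in> parcs G. fst a = v}"
          proof
            fix e assume e: "e \<in> {e \<in> edge_set G. v \<in> e}"
            then obtain w where w: "e = {v, w}" by (auto simp: edge_set_def)
            then have "(v, w) \<in> parcs G" using e edge_set_iff[OF assms(1)] by simp
            then show "e \<in> (\<lambda>(x, y). {x, y}) ` {a \<in> parcs G. fst a = v}"
              using w by force
          qed
        qed (auto simp: edge_set_def)
      qed
      from bij_betw_same_card[OF this] have "card {e \<in> edge_set G. v \<in> e} = out_degree (with_proj G) v"
        by (simp add: out_degree_def out_arcs_def)
      then show ?thesis using assms(2) v by (simp add: regular_def)
    qed
  qed
qed

text \<open>Among pairs of colours below \<open>q\<close>, the missing arcs are precisely the loops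
  at colours below \<open>l\<close>.\<close>

lemma hom_count_complete_looped_del:
  assumes "pair_graph G"
  shows "hom_count G (complete_looped_del q l) = proper_count (pverts G) (edge_set G) q l"
proof -
  interpret pair_graph G by fact
  have "graph_homs G (complete_looped_del q l)
     = {f \<in> pverts G \<rightarrow>\<^sub>E {..<q}. \<forall>e\<in>edge_set G. \<not> constant_below l f e}"
    unfolding graph_homs_def
  proof (intro Collect_cong conj_cong)
    show "(f \<in> pverts G \<rightarrow>\<^sub>E pverts (complete_looped_del q l)) = (f \<in> pverts G \<rightarrow>\<^sub>E {..<q})" for f
      by (simp add: complete_looped_del_def complete_looped_def)
    fix f assume f: "f \<in> pverts G \<rightarrow>\<^sub>E {..<q}"
    have arc: "(f u, f v) \<in> parcs (complete_looped_del q l) \<longleftrightarrow> \<not> constant_below l f {u, v}"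
      if "(u, v) \<in> parcs G" for u v
    proof -
      have "f u < q" "f v < q" using f in_arcsD1[OF that] in_arcsD2[OF that] by (auto simp: PiE_def Pi_def)
      then show ?thesis
        by (auto simp: complete_looped_del_def complete_looped_def constant_below_pair)
    qed
    show "(\<forall>u v. (u, v) \<in> parcs G \<longrightarrow> (f u, f v) \<in> parcs (complete_looped_del q l))
      \<longleftrightarrow> (\<forall>e\<in>edge_set G. \<not> constant_below l f e)"
      using arc by (auto simp: edge_set_def)
  qed
  then show ?thesis by (simp add: hom_count_def proper_count_def)
qed

lemma hom_count_isomorphic:
  assumes bij: "bij_betw \<phi> (pverts G) (pverts K)"
    and arcs: "parcs K = (\<lambda>(u, v). (\<phi> u, \<phi> v)) ` parcs G" and wf: "parcs G \<subseteq> pverts G \<times> pverts G"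
  shows "hom_count G H = hom_count K H"
proof -
  let ?V = "pverts G" and ?W = "pverts K"
  let ?\<psi> = "inv_into ?V \<phi>"
  have \<psi>: "?\<psi> y \<in> ?V" "\<phi> (?\<psi> y) = y" if "y \<in> ?W" for y
    using bij that by (auto simp: bij_betw_def inv_into_into f_inv_into_f)
  have \<phi>: "\<phi> x \<in> ?W" "?\<psi> (\<phi> x) = x" if "x \<in> ?V" for x
    using bij that by (auto simp: bij_betw_def)
  have "bij_betw (\<lambda>f. \<lambda>x\<in>?V. f (\<phi> x)) (graph_homs K H) (graph_homs G H)"
  proof (rule bij_betw_byWitness[where f' = "\<lambda>f. \<lambda>y\<in>?W. f (?\<psi> y)"])
    show "\<forall>f\<in>graph_homs K H. (\<lambda>y\<in>?W. (\<lambda>x\<in>?V. f (\<phi> x)) (?\<psi> y)) = f"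
      using \<psi> by (auto simp: graph_homs_def fun_eq_iff restrict_def PiE_def extensional_def)
    show "\<forall>f\<in>graph_homs G H. (\<lambda>x\<in>?V. (\<lambda>y\<in>?W. f (?\<psi> y)) (\<phi> x)) = f"
      using \<phi> by (auto simp: graph_homs_def fun_eq_iff restrict_def PiE_def extensional_def)
    show "(\<lambda>f. \<lambda>x\<in>?V. f (\<phi> x)) ` graph_homs K H \<subseteq> graph_homs G H"
    proof
      fix g assume "g \<in> (\<lambda>f. \<lambda>x\<in>?V. f (\<phi> x)) ` graph_homs K H"
      then obtain f where f: "f \<in> graph_homs K H" "g = (\<lambda>x\<in>?V. f (\<phi> x))" by blast
      have "g \<in> ?V \<rightarrow>\<^sub>E pverts H" using f \<phi> by (auto simp: graph_homs_def)
      moreover have "(g u, g v) \<in> parcs H" if "(u, v) \<in> parcs G" for u v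
      proof -
        have "(\<phi> u, \<phi> v) \<in> parcs K" using arcs that by force
        then have "(f (\<phi> u), f (\<phi> v)) \<in> parcs H" using f by (simp add: graph_homs_def)
        then show ?thesis using wf that f by auto
      qed
      ultimately show "g \<in> graph_homs G H" by (simp add: graph_homs_def)
    qed
    show "(\<lambda>f. \<lambda>y\<in>?W. f (?\<psi> y)) ` graph_homs G H \<subseteq> graph_homs K H"
    proof
      fix g assume "g \<in> (\<lambda>f. \<lambda>y\<in>?W. f (?\<psi> y)) ` graph_homs G H"
      then obtain f where f: "f \<in> graph_homs G H" "g = (\<lambda>y\<in>?W. f (?\<psi> y))" by blast
      have "g \<in> ?W \<rightarrow>\<^sub>E pverts H" using f \<psi> by (auto simp: graph_homs_def)
      moreover have "(g x, g y) \<in> parcs H" if xy: "(x, y) \<in> parcs K" for x y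
      proof -
        obtain u v where uv: "(u, v) \<in> parcs G" "x = \<phi> u" "y = \<phi> v" using arcs xy by auto
        then have "u \<in> ?V" "v \<in> ?V" using wf by auto
        then show ?thesis using uv f \<phi> by (simp add: graph_homs_def)
      qed
      ultimately show "g \<in> graph_homs K H" by (simp add: graph_homs_def)
    qed
  qed
  then show ?thesis
    unfolding hom_count_def by (rule bij_betw_same_card[symmetric])
qed

text \<open>A digraph isomorphism carries its own arc map. Because head and tail in
  \<open>with_proj K\<close> are the projections, that map must act on arcs through the vertex
  map.\<close>

lemma digraph_iso_imp_hom_count_eq:
  assumes "pair_graph G" "digraph_iso (with_proj G) (with_proj K)"
  shows "hom_count G H = hom_count K H"
proof -
  interpret pair_graph G by fact
  obtain \<eta> where \<eta>: "digraph_isomorphism \<eta>" and K: "with_proj K = app_iso \<eta> (with_proj G)"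
    using assms(2) unfolding digraph_iso_def by blast
  let ?\<phi> = "iso_verts \<eta>"
  have KV: "pverts K = ?\<phi> ` pverts G" using arg_cong[OF K, of verts] by simp
  have KA: "parcs K = iso_arcs \<eta> ` parcs G" using arg_cong[OF K, of arcs] by simp
  have Kt: "iso_tail \<eta> = fst" using arg_cong[OF K, of tail] by simp
  have Kh: "iso_head \<eta> = snd" using arg_cong[OF K, of head] by simp
  have "iso_arcs \<eta> a = (?\<phi> (fst a), ?\<phi> (snd a))" if "a \<in> parcs G" for a
    using \<eta> that Kt Kh by (auto simp: digraph_isomorphism_def prod_eq_iff)
  then have "parcs K = (\<lambda>(u, v). (?\<phi> u, ?\<phi> v)) ` parcs G"
    using KA by (auto simp: image_iff split_def)
  moreover have "bij_betw ?\<phi> (pverts G) (pverts K)"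
    using \<eta> KV by (auto simp: digraph_isomorphism_def bij_betw_def)
  moreover have "parcs G \<subseteq> pverts G \<times> pverts G"
    by (auto dest: in_arcsD1 in_arcsD2)
  ultimately show ?thesis by (intro hom_count_isomorphic)
qed

lemma digraph_isoI:
  assumes "pair_graph G" "bij_betw h (pverts G) (pverts K)" "parcs K \<subseteq> pverts K \<times> pverts K"
    and adj: "\<And>x y. x \<in> pverts G \<Longrightarrow> y \<in> pverts G \<Longrightarrow> (x, y) \<in> parcs G \<longleftrightarrow> (h x, h y) \<in> parcs K"
  shows "digraph_iso (with_proj G) (with_proj K)"
proof -
  interpret pair_graph G by fact
  let ?\<eta> = "\<lparr>iso_verts = h, iso_arcs = (\<lambda>(u, v). (h u, h v)), iso_head = snd, iso_tail = fst\<rparr>"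
  have inj: "inj_on h (pverts G)" and img: "h ` pverts G = pverts K"
    using assms(2) by (auto simp: bij_betw_def)
  have wf: "parcs G \<subseteq> pverts G \<times> pverts G" by (auto dest: in_arcsD1 in_arcsD2)
  have "inj_on (\<lambda>(u, v). (h u, h v)) (parcs G)"
    using inj_on_subset[OF map_prod_inj_on[OF inj inj] wf] by (simp add: map_prod_def)
  then have "digraph_isomorphism ?\<eta>"
    using inj wf_digraph by (simp add: digraph_isomorphism_def split_def)
  moreover have "parcs K = (\<lambda>(u, v). (h u, h v)) ` parcs G"
  proof
    show "(\<lambda>(u, v). (h u, h v)) ` parcs G \<subseteq> parcs K"
      using adj by (auto dest: in_arcsD1 in_arcsD2)
    show "parcs K \<subseteq> (\<lambda>(u, v). (h u, h v)) ` parcs G"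
    proof
      fix p assume p: "p \<in> parcs K"
      then have "fst p \<in> h ` pverts G" "snd p \<in> h ` pverts G" using assms(3) img by auto
      then obtain x y where xy: "x \<in> pverts G" "y \<in> pverts G" "p = (h x, h y)"
        by (metis imageE prod.collapse)
      then have "(x, y) \<in> parcs G" using adj p by simp
      then show "p \<in> (\<lambda>(u, v). (h u, h v)) ` parcs G" using xy by force
    qed
  qed
  then have "with_proj K = app_iso ?\<eta> (with_proj G)"
    using img by (simp add: with_proj_def app_iso_def)
  ultimately show ?thesis unfolding digraph_iso_def by blast
qed

text \<open>Currying turns a map on the copies into one map per copy; no arcs run between copies, so
  the homomorphism conditions separate.\<close>

lemma hom_count_disjoint_copies:
  assumes wf: "parcs B \<subseteq> pverts B \<times> pverts B"
  shows "hom_count (disjoint_copies k B) H = hom_count B H ^ k"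
proof -
  let ?V = "pverts B"
  have "bij_betw (\<lambda>f. \<lambda>i\<in>{..<k}. \<lambda>v\<in>?V. f (i, v)) (graph_homs (disjoint_copies k B) H)
      ({..<k} \<rightarrow>\<^sub>E graph_homs B H)"
  proof (rule bij_betw_byWitness[where f' = "\<lambda>g. \<lambda>(i, v)\<in>{..<k} \<times> ?V. g i v"])
    show "\<forall>f\<in>graph_homs (disjoint_copies k B) H.
        (\<lambda>(i, v)\<in>{..<k} \<times> ?V. (\<lambda>i\<in>{..<k}. \<lambda>v\<in>?V. f (i, v)) i v) = f"
      by (auto simp: graph_homs_def disjoint_copies_def fun_eq_iff restrict_def PiE_def extensional_def)
    show "\<forall>g\<in>{..<k} \<rightarrow>\<^sub>E graph_homs B H.
        (\<lambda>i\<in>{..<k}. \<lambda>v\<in>?V. (\<lambda>(i, v)\<in>{..<k} \<times> ?V. g i v) (i, v)) = g"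
    proof
      fix g assume g: "g \<in> {..<k} \<rightarrow>\<^sub>E graph_homs B H"
      \<comment> \<open>Uncurrying forgets the values off the vertex set, so recovering
        \<open>g\<close> relies on each component being extensional.\<close>
      have "g i v = undefined" if "i < k" "v \<notin> ?V" for i v
        using PiE_mem[OF g, of i] that by (auto simp: graph_homs_def PiE_def extensional_def)
      moreover have "g i = undefined" if "\<not> i < k" for i
        using g that by (auto simp: PiE_def extensional_def)
      ultimately show "(\<lambda>i\<in>{..<k}. \<lambda>v\<in>?V. (\<lambda>(i, v)\<in>{..<k} \<times> ?V. g i v) (i, v)) = g"
        by (auto simp: fun_eq_iff restrict_def)
    qed
    show "(\<lambda>f. \<lambda>i\<in>{..<k}. \<lambda>v\<in>?V. f (i, v)) ` graph_homs (disjoint_copies k B) H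
        \<subseteq> {..<k} \<rightarrow>\<^sub>E graph_homs B H"
    proof (rule image_subsetI)
      fix f assume f: "f \<in> graph_homs (disjoint_copies k B) H"
      have "(\<lambda>v\<in>?V. f (i, v)) \<in> graph_homs B H" if i: "i < k" for i
      proof -
        have "(f (i, u), f (i, v)) \<in> parcs H" if "(u, v) \<in> parcs B" for u v
          using f i that by (auto simp: graph_homs_def disjoint_copies_def)
        moreover have "f (i, v) \<in> pverts H" if "v \<in> ?V" for v
          using f i that by (auto simp: graph_homs_def disjoint_copies_def)
        ultimately show ?thesis using wf by (auto simp: graph_homs_def)
      qed
      then show "(\<lambda>i\<in>{..<k}. \<lambda>v\<in>?V. f (i, v)) \<in> {..<k} \<rightarrow>\<^sub>E graph_homs B H" by simp
    qed
    show "(\<lambda>g. \<lambda>(i, v)\<in>{..<k} \<times> ?V. g i v) ` ({..<k} \<rightarrow>\<^sub>E graph_homs B H)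
        \<subseteq> graph_homs (disjoint_copies k B) H"
    proof (rule image_subsetI)
      fix g assume g: "g \<in> {..<k} \<rightarrow>\<^sub>E graph_homs B H"
      have gi: "g i \<in> graph_homs B H" if "i < k" for i using PiE_mem[OF g] that by simp
      have "g i v \<in> pverts H" if "i < k" "v \<in> ?V" for i v
        using gi[OF that(1)] that(2) by (auto simp: graph_homs_def)
      moreover have "(g i u, g i v) \<in> parcs H" if "i < k" "(u, v) \<in> parcs B" for i u v
        using gi[OF that(1)] that(2) by (simp add: graph_homs_def)
      ultimately show "(\<lambda>(i, v)\<in>{..<k} \<times> ?V. g i v) \<in> graph_homs (disjoint_copies k B) H"
        using wf by (auto simp: graph_homs_def disjoint_copies_def)
    qed
  qed
  then have "hom_count (disjoint_copies k B) H = card ({..<k} \<rightarrow>\<^sub>E graph_homs B H)"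
    unfolding hom_count_def by (rule bij_betw_same_card)
  then show ?thesis by (simp add: card_PiE hom_count_def)
qed

section \<open>The disjoint union of copies of K_{d,d} as a regular graph\<close>

lemma complete_bipartite_arcs_subset:
  "parcs (complete_bipartite a b) \<subseteq> pverts (complete_bipartite a b) \<times> pverts (complete_bipartite a b)"
  by (auto simp: complete_bipartite_def)

lemma pverts_copies: "pverts (disjoint_copies k (complete_bipartite d d)) = bipartite_blocks k d"
  by (simp add: disjoint_copies_def complete_bipartite_def bipartite_blocks_def)

lemma parcs_copies:
  "(p, r) \<in> parcs (disjoint_copies k (complete_bipartite d d))
    \<longleftrightarrow> p \<in> bipartite_blocks k d \<and> r \<in> bipartite_blocks k d \<and> block_adjacent p r"
  by (cases p; cases r; cases "snd p"; cases "snd r")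
    (auto simp: disjoint_copies_def complete_bipartite_def bipartite_blocks_def block_adjacent_def)

lemma pair_graph_copies: "pair_graph (disjoint_copies k (complete_bipartite d d))" (is "pair_graph ?K")
proof -
  have sub: "parcs ?K \<subseteq> pverts ?K \<times> pverts ?K"
    by (auto simp: parcs_copies pverts_copies)
  moreover have "finite (pverts ?K)" by (simp add: pverts_copies bipartite_blocks_def)
  ultimately have "finite (parcs ?K)" using finite_subset by blast
  then show ?thesis
    using sub \<open>finite (pverts ?K)\<close>
    by unfold_locales
      (auto simp: symmetric_def sym_def parcs_copies block_adjacent_def)
qed

lemma regular_copies: "regular (disjoint_copies k (complete_bipartite d d)) d" (is "regular ?K d")
  unfolding regular_def
proof
  fix v assume v: "v \<in> pverts ?K"
  obtain i x where ix: "v = (i, x)" by (cases v)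
  \<comment> \<open>The out-neighbours of \<open>v\<close> form the whole opposite side of its own
    copy.\<close>
  let ?side = "if isl x then Inr ` {..<d} else Inl ` {..<d} :: (nat + nat) set"
  have "out_arcs (with_proj ?K) v = (\<lambda>y. (v, (i, y))) ` ?side"
  proof (rule set_eqI)
    fix a
    show "a \<in> out_arcs (with_proj ?K) v \<longleftrightarrow> a \<in> (\<lambda>y. (v, (i, y))) ` ?side"
    proof -
      obtain p j y where a: "a = (p, (j, y))" by (metis surj_pair)
      show ?thesis using v ix
        by (cases y) (auto simp: a out_arcs_def parcs_copies pverts_copies bipartite_blocks_def block_adjacent_def)
    qed
  qed
  moreover have "card ((\<lambda>y. (v, (i, y))) ` ?side) = d"
    by (subst card_image) (auto simp: inj_on_def card_image)
  ultimately show "out_degree (with_proj ?K) v = d"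
    by (simp add: out_degree_def)
qed

lemma edge_set_copies:
  "{p, r} \<in> edge_set (disjoint_copies k (complete_bipartite d d))
    \<longleftrightarrow> p \<in> bipartite_blocks k d \<and> r \<in> bipartite_blocks k d \<and> block_adjacent p r"
  by (simp add: edge_set_iff[OF pair_graph_copies] parcs_copies)

text \<open>Each edge stays in its copy and switches sides. Three switches cannot return to the
  start, and they always end at a vertex adjacent to it.\<close>

lemma copies_extremal:
  "edge_graph.triangle_free (edge_set (disjoint_copies k (complete_bipartite d d)))"
  "edge_graph.biclique_closed (edge_set (disjoint_copies k (complete_bipartite d d)))"
proof -
  interpret edge_graph "pverts (disjoint_copies k (complete_bipartite d d))"
    "edge_set (disjoint_copies k (complete_bipartite d d))" d
    by (rule edge_graph_edge_set[OF pair_graph_copies regular_copies])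
  show triangle_free
    by (rule triangle_freeI) (auto simp: edge_set_copies block_adjacent_def)
  show biclique_closed
    unfolding biclique_closed_def by (auto simp: edge_set_copies block_adjacent_def)
qed

theorem theorem1p4:
  fixes G :: "'a pair_pre_digraph" and n d q l :: nat
  assumes "d \<ge> 1" and "2 * d dvd n"
    and "pair_graph G" and "card (pverts G) = n" and "regular G d"
    and "l \<ge> 1" and "q \<ge> l"
    and "q > 2 ^ (n * d div 2)"
  shows "hom_count G (complete_looped_del q l)
           \<le> hom_count (complete_bipartite d d) (complete_looped_del q l) ^ (n div (2 * d))
       \<and> (hom_count G (complete_looped_del q l)
            = hom_count (complete_bipartite d d) (complete_looped_del q l) ^ (n div (2 * d))
          \<longleftrightarrow> digraph_iso (with_proj G)
                (with_proj (disjoint_copies (n div (2 * d)) (complete_bipartite d d))))"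
proof -
  let ?k = "n div (2 * d)"
  let ?K = "disjoint_copies ?k (complete_bipartite d d)"
  let ?H = "complete_looped_del q l"
  interpret G: edge_graph "pverts G" "edge_set G" d
    by (rule edge_graph_edge_set[OF assms(3,5)])
  interpret K: edge_graph "pverts ?K" "edge_set ?K" d
    by (rule edge_graph_edge_set[OF pair_graph_copies regular_copies])
  have n: "n = ?k * (2 * d)" using assms(2) by simp
  have "card (bipartite_blocks ?k d) = ?k * (2 * d)"
    by (simp add: bipartite_blocks_def card_cartesian_product card_Plus)
  then have card: "card (pverts G) = card (pverts ?K)"
    using n assms(4) pverts_copies by simp
  \<comment> \<open>By the handshake identity \<open>n * d\<close> is even, so the division is
    exact.\<close>
  have "card (edge_set G) = n * d div 2"
    using G.handshake assms(4) by simp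
  then have q: "2 ^ card (edge_set G) < q" using assms(8) by simp
  have power: "hom_count (complete_bipartite d d) ?H ^ ?k = hom_count ?K ?H"
    by (rule hom_count_disjoint_copies[OF complete_bipartite_arcs_subset, symmetric])
  show ?thesis
    unfolding power
  proof (cases "G.triangle_free \<and> G.biclique_closed")
    case True
    obtain h where "bij_betw h (pverts G) (bipartite_blocks ?k d)"
      and "\<forall>x\<in>pverts G. \<forall>y\<in>pverts G. {x, y} \<in> edge_set G \<longleftrightarrow> block_adjacent (h x) (h y)"
      using biclique_decomposition[OF G.edge_graph_axioms _ _ _ assms(1), of ?k] True n assms(4) by auto
    then have "digraph_iso (with_proj G) (with_proj ?K)"
      by (intro digraph_isoI[OF assms(3), of h])
        (auto simp: pverts_copies parcs_copies edge_set_iff[OF assms(3)] dest: bij_betwE)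
    moreover from this have "hom_count G ?H = hom_count ?K ?H"
      by (rule digraph_iso_imp_hom_count_eq[OF assms(3)])
    ultimately show "hom_count G ?H \<le> hom_count ?K ?H
      \<and> (hom_count G ?H = hom_count ?K ?H \<longleftrightarrow> digraph_iso (with_proj G) (with_proj ?K))"
      by simp
  next
    case False
    \<comment> \<open>Strictness settles the equivalence as well: an isomorphism would make the
      counts equal.\<close>
    have "hom_count G ?H < hom_count ?K ?H"
      unfolding hom_count_complete_looped_del[OF assms(3)] hom_count_complete_looped_del[OF pair_graph_copies]
      by (rule proper_count_less[OF G.edge_graph_axioms K.edge_graph_axioms card assms(6,7) q copies_extremal False])
    then show "hom_count G ?H \<le> hom_count ?K ?H
      \<and> (hom_count G ?H = hom_count ?K ?H \<longleftrightarrow> digraph_iso (with_proj G) (with_proj ?K))"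
      using digraph_iso_imp_hom_count_eq[OF assms(3), of ?K ?H] by auto
  qed
qed

end
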